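(* Let $(M,\nabla)$ be a CSLCG manifold. Then every probability measure $\mu$ on $M$ with compact support has a unique exponential barycenter, i.e. there is exactly one point $x\in M$ such that $\int_M \exp_x^{-1}y\,\mu(dy)=0$ in $T_xM$.
   Context: An affine manifold $(M,\nabla)$ is a smooth manifold with a linear connection $\nabla$, assumed torsion free. It is convex if any two points $x,y\in M$ are joined by a unique $\nabla$-geodesic $(\gamma(x,y)(s),0\le s\le 1)$ with $\gamma(x,y)(0)=x$, $\gamma(x,y)(1)=y$, depending smoothly on $(x,y)$; then $\exp_x^{-1}y=\dot\gamma(x,y)(0)$. A subset $U\subset M$ of a convex affine manifold is convex if $\gamma(x,y)([0,1])\subset U$ for all $x,y\in U$; an open convex subset is itself a convex affine manifold. A function on an affine manifold is convex if its restriction to every geodesic is convex. A separating function on an affine manifold $N$ is a convex function $\phi:N\times N\to\mathbb{R}_+$ (for the product connection) vanishing exactly on the diagonal. For $p\in 2\mathbb{N}$, $N$ has $p$-convex geometry if it carries a smooth separating function $\phi$ with $c\rho^p\le\phi\le C\rho^p$ for some constants $0<c<C$ and some Riemannian distance function $\rho$. A convex affine manifold $(M,\nabla)$ is CSLCG (convex, with semilocal convex geometry) if every compact subset $K$ of $M$ has a relatively compact convex (open) neighborhood $U_K$ which has $p$-convex geometry for some $p\in 2\mathbb{N}$ depending on $K$. A point $x\in M$ is an exponential barycenter of a probability measure $\mu$ on $M$ if $\int_M\exp_x^{-1}y\,\mu(dy)=0$. *)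

theory Defs
  imports "HOL-Probability.Probability"
begin

text \<open>
  Finite-dimensional smooth manifolds are modelled on a type \<open>'e\<close> of class
  \<^class>\<open>euclidean_space\<close>. A manifold is presented by an atlas on an open subset of a Hausdorff second
  countable type \<open>'a\<close>. Each chart also carries the Christoffel symbols of the connection in its
  coordinates, so that an atlas presents a manifold together with a linear connection. Atlases
  need not be maximal.
\<close>

section \<open>Smooth functions on open subsets of normed spaces\<close>

primrec Ck_on :: "nat \<Rightarrow> 'a::real_normed_vector set \<Rightarrow> ('a \<Rightarrow> 'b::real_normed_vector) \<Rightarrow> bool" where
  "Ck_on 0 S f \<longleftrightarrow> continuous_on S f"
| "Ck_on (Suc k) S f \<longleftrightarrow>
     (\<forall>x\<in>S. f differentiable (at x)) \<and> (\<forall>v. Ck_on k S (\<lambda>x. frechet_derivative f (at x) v))"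

definition smooth_on :: "'a::real_normed_vector set \<Rightarrow> ('a \<Rightarrow> 'b::real_normed_vector) \<Rightarrow> bool" where
  "smooth_on S f \<longleftrightarrow> (\<forall>k. Ck_on k S f)"


section \<open>Manifolds with a linear connection\<close>

record ('a, 'e) affine_chart =
  chart_dom :: "'a set"
  coord :: "'a \<Rightarrow> 'e"
  christoffel :: "'e \<Rightarrow> 'e \<Rightarrow> 'e \<Rightarrow> 'e"

type_synonym ('a, 'e) affine_atlas = "('a, 'e) affine_chart set"

definition coord_image :: "('a, 'e) affine_chart \<Rightarrow> 'e set" where
  "coord_image c = coord c ` chart_dom c"

definition coord_inv :: "('a, 'e) affine_chart \<Rightarrow> 'e \<Rightarrow> 'a" where
  "coord_inv c = inv_into (chart_dom c) (coord c)"

definition transition :: "('a, 'e) affine_chart \<Rightarrow> ('a, 'f) affine_chart \<Rightarrow> 'e \<Rightarrow> 'f" where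
  "transition c d = coord d \<circ> coord_inv c"

definition carrier_of :: "('a, 'e) affine_atlas \<Rightarrow> 'a set" where
  "carrier_of A = (\<Union>c\<in>A. chart_dom c)"

definition smooth_atlas ::
    "('a::{t2_space,second_countable_topology}, 'e::euclidean_space) affine_atlas \<Rightarrow> bool" where
  "smooth_atlas A \<longleftrightarrow>
     (\<forall>c\<in>A. open (chart_dom c) \<and> open (coord_image c) \<and>
        homeomorphism (chart_dom c) (coord_image c) (coord c) (coord_inv c)) \<and>
     (\<forall>c\<in>A. \<forall>d\<in>A. smooth_on (coord c ` (chart_dom c \<inter> chart_dom d)) (transition c d))"

text \<open>
  With \<open>\<nabla>\<^sub>u v = D v u + \<Gamma>(u, v)\<close> for vector fields in coordinates, the last clause is the
  transformation law \<open>D\<psi> (\<Gamma>\<^sub>c(u,v)) = D\<^sup>2\<psi>(u,v) + \<Gamma>\<^sub>d(D\<psi> u, D\<psi> v)\<close> for a transition map \<open>\<psi>\<close>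
  from \<open>c\<close> to \<open>d\<close>, i.e. the independence of \<open>\<nabla>\<close> of the chart.
\<close>

definition linear_connection ::
    "('a::{t2_space,second_countable_topology}, 'e::euclidean_space) affine_atlas \<Rightarrow> bool" where
  "linear_connection A \<longleftrightarrow>
     (\<forall>c\<in>A. (\<forall>x\<in>coord_image c. bilinear (christoffel c x)) \<and>
        (\<forall>u v. smooth_on (coord_image c) (\<lambda>x. christoffel c x u v))) \<and>
     (\<forall>c\<in>A. \<forall>d\<in>A. \<forall>x\<in>coord c ` (chart_dom c \<inter> chart_dom d). \<forall>u v.
        (let D = \<lambda>z. frechet_derivative (transition c d) (at z) in
          D x (christoffel c x u v) =
            frechet_derivative (\<lambda>z. D z v) (at x) u
            + christoffel d (transition c d x) (D x u) (D x v)))"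

definition torsion_free :: "('a, 'e) affine_atlas \<Rightarrow> bool" where
  "torsion_free A \<longleftrightarrow>
     (\<forall>c\<in>A. \<forall>x\<in>coord_image c. \<forall>u v. christoffel c x u v = christoffel c x v u)"

definition affine_manifold ::
    "('a::{t2_space,second_countable_topology}, 'e::euclidean_space) affine_atlas \<Rightarrow> bool" where
  "affine_manifold A \<longleftrightarrow> smooth_atlas A \<and> linear_connection A \<and> torsion_free A"

definition restrict_atlas :: "'a set \<Rightarrow> ('a, 'e) affine_atlas \<Rightarrow> ('a, 'e) affine_atlas" where
  "restrict_atlas U A = (\<lambda>c. c\<lparr>chart_dom := chart_dom c \<inter> U\<rparr>) ` A"

definition prod_chart ::
    "('a, 'e) affine_chart \<Rightarrow> ('b, 'f) affine_chart \<Rightarrow> ('a \<times> 'b, 'e \<times> 'f) affine_chart" where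
  "prod_chart c d =
     \<lparr>chart_dom = chart_dom c \<times> chart_dom d,
      coord = map_prod (coord c) (coord d),
      christoffel = (\<lambda>(x, y) (u, u') (v, v'). (christoffel c x u v, christoffel d y u' v'))\<rparr>"

definition prod_atlas ::
    "('a, 'e) affine_atlas \<Rightarrow> ('b, 'f) affine_atlas \<Rightarrow> ('a \<times> 'b, 'e \<times> 'f) affine_atlas" where
  "prod_atlas A B = {prod_chart c d | c d. c \<in> A \<and> d \<in> B}"

definition euclidean_atlas :: "('e::euclidean_space, 'e) affine_atlas" where
  "euclidean_atlas = {\<lparr>chart_dom = UNIV, coord = (\<lambda>x. x), christoffel = (\<lambda>_ _ _. 0)\<rparr>}"

text \<open>
  Smoothness of a map defined on a subset \<open>S\<close> of a manifold, not necessarily open, means local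
  smooth extendability in charts. This covers sets such as \<open>M \<times> M \<times> {0..1}\<close>, smooth up to the
  boundary.
\<close>

definition smooth_map_on ::
    "('a, 'e::euclidean_space) affine_atlas \<Rightarrow> 'a set
      \<Rightarrow> ('b, 'f::euclidean_space) affine_atlas \<Rightarrow> ('a \<Rightarrow> 'b) \<Rightarrow> bool" where
  "smooth_map_on A S B f \<longleftrightarrow>
     S \<subseteq> carrier_of A \<and> f ` S \<subseteq> carrier_of B \<and>
     (\<forall>x\<in>S. \<forall>c\<in>A. \<forall>d\<in>B. x \<in> chart_dom c \<longrightarrow> f x \<in> chart_dom d \<longrightarrow>
        (\<exists>W g. open W \<and> coord c x \<in> W \<and> W \<subseteq> coord_image c \<and> smooth_on W g \<and>
           (\<forall>z\<in>W. coord_inv c z \<in> S \<longrightarrow>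
              f (coord_inv c z) \<in> chart_dom d \<and> coord d (f (coord_inv c z)) = g z)))"


section \<open>Geodesics and convexity\<close>

text \<open>
  The function \<open>w\<close> is the velocity of \<open>\<gamma>\<close> in the chart \<open>c\<close>; derivatives at endpoints of \<open>T\<close>
  are one-sided.
\<close>

definition geodesic_on :: 
    "('a::topological_space, 'e::euclidean_space) affine_atlas \<Rightarrow> real set \<Rightarrow> (real \<Rightarrow> 'a) \<Rightarrow> bool" where
  "geodesic_on A T \<gamma> \<longleftrightarrow>
     continuous_on T \<gamma> \<and> \<gamma> ` T \<subseteq> carrier_of A \<and>
     (\<forall>c\<in>A. \<exists>w. \<forall>s\<in>T. \<gamma> s \<in> chart_dom c \<longrightarrow>
        ((\<lambda>t. coord c (\<gamma> t)) has_vector_derivative w s) (at s within T) \<and>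
        (w has_vector_derivative - christoffel c (coord c (\<gamma> s)) (w s) (w s)) (at s within T))"

definition geodesic_from_to ::
    "('a::topological_space, 'e::euclidean_space) affine_atlas \<Rightarrow> 'a \<Rightarrow> 'a \<Rightarrow> (real \<Rightarrow> 'a) \<Rightarrow> bool" where
  "geodesic_from_to A x y \<gamma> \<longleftrightarrow> geodesic_on A {0..1} \<gamma> \<and> \<gamma> 0 = x \<and> \<gamma> 1 = y"

text \<open>Only the values on \<open>{0..1}\<close> are meaningful.\<close>

definition geod ::
    "('a::topological_space, 'e::euclidean_space) affine_atlas \<Rightarrow> 'a \<Rightarrow> 'a \<Rightarrow> real \<Rightarrow> 'a" where
  "geod A x y = (SOME \<gamma>. geodesic_from_to A x y \<gamma>)"

definition convex_affine_manifold ::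
    "('a::{t2_space,second_countable_topology}, 'e::euclidean_space) affine_atlas \<Rightarrow> bool" where
  "convex_affine_manifold A \<longleftrightarrow>
     affine_manifold A \<and>
     (\<forall>x\<in>carrier_of A. \<forall>y\<in>carrier_of A.
        (\<exists>\<gamma>. geodesic_from_to A x y \<gamma>) \<and>
        (\<forall>\<gamma> \<gamma>'. geodesic_from_to A x y \<gamma> \<longrightarrow> geodesic_from_to A x y \<gamma>' \<longrightarrow>
           (\<forall>s\<in>{0..1}. \<gamma> s = \<gamma>' s))) \<and>
     smooth_map_on (prod_atlas A (prod_atlas A (euclidean_atlas :: (real, real) affine_atlas)))
       (carrier_of A \<times> carrier_of A \<times> {0..1}) A (\<lambda>(x, y, s). geod A x y s)"

definition convex_subset ::
    "('a::topological_space, 'e::euclidean_space) affine_atlas \<Rightarrow> 'a set \<Rightarrow> bool" where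
  "convex_subset A U \<longleftrightarrow>
     U \<subseteq> carrier_of A \<and> (\<forall>x\<in>U. \<forall>y\<in>U. geod A x y ` {0..1} \<subseteq> U)"

definition convex_function ::
    "('a::topological_space, 'e::euclidean_space) affine_atlas \<Rightarrow> ('a \<Rightarrow> real) \<Rightarrow> bool" where
  "convex_function A f \<longleftrightarrow>
     (\<forall>T \<gamma>. is_interval T \<longrightarrow> geodesic_on A T \<gamma> \<longrightarrow> convex_on T (\<lambda>s. f (\<gamma> s)))"

text \<open>The representation of the tangent vector \<open>exp\<^sub>x\<^sup>-\<^sup>1 y\<close> at \<open>x\<close> in the chart \<open>c\<close>.\<close>

definition exp_inv ::
    "('a::topological_space, 'e::euclidean_space) affine_atlas
      \<Rightarrow> ('a, 'e) affine_chart \<Rightarrow> 'a \<Rightarrow> 'a \<Rightarrow> 'e" where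
  "exp_inv A c x y = vector_derivative (\<lambda>s. coord c (geod A x y s)) (at 0 within {0..1})"


section \<open>Riemannian distance functions\<close>

text \<open>\<open>g c x\<close> is the inner product on the tangent space in the coordinates of the chart \<open>c\<close>.\<close>

definition riemannian_metric ::
    "('a, 'e::euclidean_space) affine_atlas
      \<Rightarrow> (('a, 'e) affine_chart \<Rightarrow> 'e \<Rightarrow> 'e \<Rightarrow> 'e \<Rightarrow> real) \<Rightarrow> bool" where
  "riemannian_metric A g \<longleftrightarrow>
     (\<forall>c\<in>A.
        (\<forall>x\<in>coord_image c. bilinear (g c x) \<and> (\<forall>u v. g c x u v = g c x v u) \<and>
           (\<forall>v. v \<noteq> 0 \<longrightarrow> 0 < g c x v v)) \<and>
        (\<forall>u v. smooth_on (coord_image c) (\<lambda>x. g c x u v))) \<and>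
     (\<forall>c\<in>A. \<forall>d\<in>A. \<forall>x\<in>coord c ` (chart_dom c \<inter> chart_dom d). \<forall>u v.
        (let D = frechet_derivative (transition c d) (at x) in
          g c x u v = g d (transition c d x) (D u) (D v)))"

definition C1_curve_on ::
    "('a::topological_space, 'e::euclidean_space) affine_atlas \<Rightarrow> real set \<Rightarrow> (real \<Rightarrow> 'a) \<Rightarrow> bool" where
  "C1_curve_on A T \<gamma> \<longleftrightarrow>
     continuous_on T \<gamma> \<and> \<gamma> ` T \<subseteq> carrier_of A \<and>
     (\<forall>c\<in>A. \<exists>w. \<forall>s\<in>T. \<gamma> s \<in> chart_dom c \<longrightarrow>
        ((\<lambda>t. coord c (\<gamma> t)) has_vector_derivative w s) (at s within T) \<and>
        continuous (at s within T) w)"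

definition piecewise_C1_curve ::
    "('a::topological_space, 'e::euclidean_space) affine_atlas \<Rightarrow> (real \<Rightarrow> 'a) \<Rightarrow> bool" where
  "piecewise_C1_curve A \<gamma> \<longleftrightarrow>
     (\<exists>n t. t 0 = 0 \<and> t n = 1 \<and>
        (\<forall>i<n. t i < t (Suc i) \<and> C1_curve_on A {t i..t (Suc i)} \<gamma>))"

text \<open>
  The speed does not depend on the chosen chart wherever \<open>\<gamma>\<close> is differentiable; the remaining
  finitely many points do not affect the length.
\<close>

definition speed ::
    "('a, 'e::euclidean_space) affine_atlas
      \<Rightarrow> (('a, 'e) affine_chart \<Rightarrow> 'e \<Rightarrow> 'e \<Rightarrow> 'e \<Rightarrow> real) \<Rightarrow> (real \<Rightarrow> 'a) \<Rightarrow> real \<Rightarrow> real" where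
  "speed A g \<gamma> t =
     (let c = (SOME c. c \<in> A \<and> \<gamma> t \<in> chart_dom c);
          w = vector_derivative (\<lambda>s. coord c (\<gamma> s)) (at t)
      in sqrt (g c (coord c (\<gamma> t)) w w))"

text \<open>
  The distance is meaningful on connected manifolds; a nonempty convex affine manifold is connected.
\<close>

definition riemannian_dist ::
    "('a::topological_space, 'e::euclidean_space) affine_atlas
      \<Rightarrow> (('a, 'e) affine_chart \<Rightarrow> 'e \<Rightarrow> 'e \<Rightarrow> 'e \<Rightarrow> real) \<Rightarrow> 'a \<Rightarrow> 'a \<Rightarrow> real" where
  "riemannian_dist A g x y =
     Inf {integral {0..1} (speed A g \<gamma>) | \<gamma>. piecewise_C1_curve A \<gamma> \<and> \<gamma> 0 = x \<and> \<gamma> 1 = y}"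


section \<open>Convex geometry\<close>

definition separating_function ::
    "('a::topological_space, 'e::euclidean_space) affine_atlas \<Rightarrow> ('a \<times> 'a \<Rightarrow> real) \<Rightarrow> bool" where
  "separating_function N \<phi> \<longleftrightarrow>
     convex_function (prod_atlas N N) \<phi> \<and>
     (\<forall>x\<in>carrier_of N. \<forall>y\<in>carrier_of N. 0 \<le> \<phi> (x, y) \<and> (\<phi> (x, y) = 0 \<longleftrightarrow> x = y))"

definition p_convex_geometry ::
    "nat \<Rightarrow> ('a::topological_space, 'e::euclidean_space) affine_atlas \<Rightarrow> bool" where
  "p_convex_geometry p N \<longleftrightarrow>
     (\<exists>\<phi> g c C. separating_function N \<phi> \<and>
        smooth_map_on (prod_atlas N N) (carrier_of N \<times> carrier_of N)
          (euclidean_atlas :: (real, real) affine_atlas) \<phi> \<and>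
        riemannian_metric N g \<and> 0 < c \<and> c < C \<and>
        (\<forall>x\<in>carrier_of N. \<forall>y\<in>carrier_of N.
           c * riemannian_dist N g x y ^ p \<le> \<phi> (x, y) \<and>
           \<phi> (x, y) \<le> C * riemannian_dist N g x y ^ p))"

definition CSLCG ::
    "('a::{t2_space,second_countable_topology}, 'e::euclidean_space) affine_atlas \<Rightarrow> bool" where
  "CSLCG A \<longleftrightarrow>
     convex_affine_manifold A \<and>
     (\<forall>K. compact K \<longrightarrow> K \<subseteq> carrier_of A \<longrightarrow>
        (\<exists>U. open U \<and> K \<subseteq> U \<and> convex_subset A U \<and> compact (carrier_of A \<inter> closure U) \<and>
           (\<exists>p. even p \<and> 0 < p \<and> p_convex_geometry p (restrict_atlas U A))))"


section \<open>Exponential barycenters\<close>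

definition prob_measure_on :: "'a::topological_space set \<Rightarrow> 'a measure \<Rightarrow> bool" where
  "prob_measure_on M \<mu> \<longleftrightarrow> prob_space \<mu> \<and> sets \<mu> = sets (restrict_space borel M)"

definition measure_support :: "'a::topological_space measure \<Rightarrow> 'a set" where
  "measure_support \<mu> =
     {x \<in> space \<mu>. \<forall>U. open U \<longrightarrow> x \<in> U \<longrightarrow> 0 < emeasure \<mu> (U \<inter> space \<mu>)}"

text \<open>
  The integral over \<open>T\<^sub>xM\<close> is taken in coordinates; the condition for one chart around \<open>x\<close> is
  equivalent to the condition for every chart, since a change of chart acts on \<open>T\<^sub>xM\<close> linearly.
\<close>

definition exponential_barycenter ::
    "('a::topological_space, 'e::euclidean_space) affine_atlas \<Rightarrow> 'a measure \<Rightarrow> 'a \<Rightarrow> bool" where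
  "exponential_barycenter A \<mu> x \<longleftrightarrow>
     x \<in> carrier_of A \<and>
     (\<forall>c\<in>A. x \<in> chart_dom c \<longrightarrow>
        integrable \<mu> (exp_inv A c x) \<and> (\<integral>y. exp_inv A c x y \<partial>\<mu>) = 0)"

end

theory Submission
  imports Defs
begin

text \<open>
  Let \<open>\<phi>\<close> be a separating function. Along two geodesics issuing from \<open>x\<close> and \<open>x'\<close> and both reaching \<open>y\<close>
  at time 1, \<open>\<phi>\<close> is convex and ends at 0, so its initial slope is at most \<open>- \<phi>(x, x')\<close>. This slope
  is linear in the pair of initial velocities; integrating over \<open>y\<close> at two barycenters gives
  \<open>0 \<le> - \<phi>(x, x')\<close>, whence uniqueness.

  For existence, discretise the measure and move a point successively towards each atom for a time
  \<open>\<epsilon>\<close> times the weight of the atom. By the same convexity the composed map contracts \<open>\<phi>\<close> by the factor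
  \<open>exp (- \<epsilon>)\<close> on a compact convex set, hence has a fixed point. As \<open>\<epsilon> \<rightarrow> 0\<close> and the discretisation is
  refined, every limit point of these fixed points is a barycenter.
\<close>

text \<open>A barycenter is a zero of the averaged field formed by the vectors
  \<open>exp_inv\<close>. Instead of integrating this field, the proof uses walks, because a single
  geodesic step is controlled directly: towards a point of a convex set it stays in that set, and if
  both arguments of \<phi> take a step of time s towards the same point, \<phi> shrinks by the
  factor 1 - s. From 1 - s \<le> exp (- s), the factor of a whole walk depends only on its total
  time. The limit requires an error that is small relative to the time of each step: for starting
  points near the limit x and all targets y in the support, a step moves the coordinates by
  \<open>s *\<^sub>R exp_inv M c x y\<close> up to \<eta> * s. The errors then add up to \<eta> *
  \<epsilon> whatever the number of atoms, so no rate has to link \<epsilon> to the discretisation.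
  A fixed point has total displacement 0, and dividing by \<epsilon> bounds the discretised integral
  by \<eta>.\<close>

section \<open>Atlases and local representations\<close>

text \<open>Keeps of an atlas what local representations need on the source side. In this form the
  property passes directly to restrictions and products, the atlases on which \<open>geod\<close>
  and \<phi> are smooth maps.\<close>

definition topological_atlas :: "('a::topological_space, 'e::topological_space) affine_atlas \<Rightarrow> bool" where
  "topological_atlas A \<longleftrightarrow> (\<forall>c\<in>A. open (chart_dom c) \<and> continuous_on (chart_dom c) (coord c) \<and>
     inj_on (coord c) (chart_dom c))"

lemma topological_atlasD:
  assumes "topological_atlas A" "c \<in> A"
  shows "open (chart_dom c)" "continuous_on (chart_dom c) (coord c)" "inj_on (coord c) (chart_dom c)"
  using assms by (auto simp: topological_atlas_def)

lemma smooth_atlas_imp_topological_atlas: "smooth_atlas A \<Longrightarrow> topological_atlas A"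
  unfolding smooth_atlas_def topological_atlas_def homeomorphism_def
  by (meson inj_on_inverseI)

lemma topological_atlas_euclidean: "topological_atlas euclidean_atlas"
  by (auto simp: topological_atlas_def euclidean_atlas_def inj_on_def)

lemma topological_atlas_restrict:
  assumes "topological_atlas A" "open U" shows "topological_atlas (restrict_atlas U A)"
  using assms unfolding topological_atlas_def restrict_atlas_def
  by (auto intro: continuous_on_subset inj_on_subset)

lemma topological_atlas_prod:
  assumes "topological_atlas A" "topological_atlas B" shows "topological_atlas (prod_atlas A B)"
proof -
  have "open (chart_dom c \<times> chart_dom d)
      \<and> continuous_on (chart_dom c \<times> chart_dom d) (map_prod (coord c) (coord d))
      \<and> inj_on (map_prod (coord c) (coord d)) (chart_dom c \<times> chart_dom d)"
    if "c \<in> A" "d \<in> B" for c d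
  proof (intro conjI)
    note c = topological_atlasD[OF assms(1) that(1)] and d = topological_atlasD[OF assms(2) that(2)]
    show "open (chart_dom c \<times> chart_dom d)" using c d by (simp add: open_Times)
    show "continuous_on (chart_dom c \<times> chart_dom d) (map_prod (coord c) (coord d))"
      unfolding map_prod_def case_prod_unfold
      by (intro continuous_intros continuous_on_compose2[OF c(2)] continuous_on_compose2[OF d(2)]) auto
    show "inj_on (map_prod (coord c) (coord d)) (chart_dom c \<times> chart_dom d)"
      using c d by (simp add: map_prod_inj_on)
  qed
  then show ?thesis by (auto simp: topological_atlas_def prod_atlas_def prod_chart_def)
qed

lemma carrier_of_prod [simp]: "carrier_of (prod_atlas A B) = carrier_of A \<times> carrier_of B"
  unfolding carrier_of_def prod_atlas_def prod_chart_def by fastforce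

lemma carrier_of_restrict [simp]: "carrier_of (restrict_atlas U A) = carrier_of A \<inter> U"
  by (auto simp: carrier_of_def restrict_atlas_def)

lemma coord_inv_coord:
  assumes "inj_on (coord c) (chart_dom c)" "x \<in> chart_dom c"
  shows "coord_inv c (coord c x) = x"
  using assms by (simp add: coord_inv_def)

lemma open_coord_vimage:
  assumes "topological_atlas A" "c \<in> A" "open W"
  shows "open {a \<in> chart_dom c. coord c a \<in> W}"
proof -
  have "open (chart_dom c \<inter> coord c -` W)"
    using topological_atlasD[OF assms(1,2)] assms(3) continuous_open_preimage by blast
  moreover have "chart_dom c \<inter> coord c -` W = {a \<in> chart_dom c. coord c a \<in> W}" by auto
  ultimately show ?thesis by simp
qed

lemma smooth_on_differentiable: "smooth_on W g \<Longrightarrow> z \<in> W \<Longrightarrow> g differentiable (at z)"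
  unfolding smooth_on_def by (metis Ck_on.simps(2))

lemma smooth_on_continuous_on: "smooth_on W g \<Longrightarrow> continuous_on W g"
  unfolding smooth_on_def by (metis Ck_on.simps(1))

lemma smooth_on_continuous_on_derivative:
  "smooth_on W g \<Longrightarrow> continuous_on W (\<lambda>z. frechet_derivative g (at z) v)"
  unfolding smooth_on_def by (metis Ck_on.simps)

text \<open>Substituting \<open>z = coord c a\<close> in \<open>smooth_map_on\<close> removes
  \<open>coord_inv\<close>. The map \<open>g\<close> is smooth on an open set even where
  \<open>S\<close> is not open, which permits differentiation at the boundary time 0 of a
  geodesic.\<close>

lemma smooth_map_on_local_rep:
  assumes "smooth_map_on A S B f" "topological_atlas A" "c \<in> A" "d \<in> B"
    "x \<in> S" "x \<in> chart_dom c" "f x \<in> chart_dom d"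
  obtains W g where "open W" "coord c x \<in> W" "smooth_on W g"
    "\<And>a. a \<in> S \<Longrightarrow> a \<in> chart_dom c \<Longrightarrow> coord c a \<in> W \<Longrightarrow>
       f a \<in> chart_dom d \<and> coord d (f a) = g (coord c a)"
proof -
  obtain W g where W: "open W" "coord c x \<in> W" "smooth_on W g" and
    *: "\<And>z. z \<in> W \<Longrightarrow> coord_inv c z \<in> S \<Longrightarrow>
      f (coord_inv c z) \<in> chart_dom d \<and> coord d (f (coord_inv c z)) = g z"
    using assms unfolding smooth_map_on_def by metis
  show ?thesis
    using that[OF W] * coord_inv_coord[OF topological_atlasD(3)[OF assms(2,3)]] by metis
qed

text \<open>Near each point \<open>f\<close> is \<open>coord_inv d\<close> after \<open>g\<close>
  after \<open>coord c\<close>; this is why continuity of \<open>coord_inv\<close> is asked of the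
  target charts.\<close>

lemma smooth_map_on_imp_continuous_on:
  assumes f: "smooth_map_on A S B f" and A: "topological_atlas A"
    and B: "\<And>d. d \<in> B \<Longrightarrow> continuous_on (coord_image d) (coord_inv d) \<and> inj_on (coord d) (chart_dom d)"
  shows "continuous_on S f"
proof -
  have local: "\<exists>N. open N \<and> x \<in> N \<and> continuous_on (S \<inter> N) f" if x: "x \<in> S" for x
  proof -
    obtain c d where cd: "c \<in> A" "d \<in> B" "x \<in> chart_dom c" "f x \<in> chart_dom d"
      using f x unfolding smooth_map_on_def carrier_of_def by blast
    obtain W g where W: "open W" "coord c x \<in> W" "smooth_on W g" and
      rep: "\<And>a. a \<in> S \<Longrightarrow> a \<in> chart_dom c \<Longrightarrow> coord c a \<in> W \<Longrightarrow>
       f a \<in> chart_dom d \<and> coord d (f a) = g (coord c a)"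
      using smooth_map_on_local_rep[OF f A cd(1,2) x cd(3,4)] by metis
    define N where "N = {a \<in> chart_dom c. coord c a \<in> W}"
    have "open N" unfolding N_def by (rule open_coord_vimage[OF A cd(1) W(1)])
    moreover have "x \<in> N" using W cd by (simp add: N_def)
    moreover have "continuous_on (S \<inter> N) f"
    proof -
      have "continuous_on (S \<inter> N) (\<lambda>a. coord_inv d (g (coord c a)))"
      proof (rule continuous_on_compose2[of "coord_image d" "coord_inv d"])
        show "continuous_on (coord_image d) (coord_inv d)" using B cd by blast
        show "continuous_on (S \<inter> N) (\<lambda>a. g (coord c a))"
          by (rule continuous_on_compose2[OF smooth_on_continuous_on[OF W(3)]])
             (auto simp: N_def intro: continuous_on_subset[OF topological_atlasD(2)[OF A cd(1)]])
        show "(\<lambda>a. g (coord c a)) ` (S \<inter> N) \<subseteq> coord_image d"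
          using rep by (force simp: N_def coord_image_def)
      qed
      moreover have "coord_inv d (g (coord c a)) = f a" if "a \<in> S \<inter> N" for a
        using rep[of a] that coord_inv_coord[of d "f a"] B[OF cd(2)] by (auto simp: N_def)
      ultimately show ?thesis by (rule continuous_on_eq)
    qed
    ultimately show ?thesis by blast
  qed
  have "(f \<longlongrightarrow> f x) (at x within S)" if x: "x \<in> S" for x
  proof -
    obtain N where N: "open N" "x \<in> N" "continuous_on (S \<inter> N) f" using local[OF x] by blast
    have "at x within S = at x within (S \<inter> N)" using N by (intro at_within_nhd[of x N]) auto
    then show ?thesis using N x by (simp add: continuous_on_def)
  qed
  then show ?thesis by (simp add: continuous_on_def)
qed

section \<open>Geodesics in a convex affine manifold\<close>

lemma convex_affine_manifoldD:
  assumes "convex_affine_manifold M"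
  shows "topological_atlas M"
    and "c \<in> M \<Longrightarrow> continuous_on (coord_image c) (coord_inv c)"
    and "x \<in> carrier_of M \<Longrightarrow> y \<in> carrier_of M \<Longrightarrow> geodesic_from_to M x y (geod M x y)"
proof -
  show "topological_atlas M"
    using assms smooth_atlas_imp_topological_atlas
    unfolding convex_affine_manifold_def affine_manifold_def by blast
  show "continuous_on (coord_image c) (coord_inv c)" if "c \<in> M"
    using assms that
    unfolding convex_affine_manifold_def affine_manifold_def smooth_atlas_def homeomorphism_def by blast
  show "geodesic_from_to M x y (geod M x y)" if "x \<in> carrier_of M" "y \<in> carrier_of M"
  proof -
    have "\<exists>\<gamma>. geodesic_from_to M x y \<gamma>"
      using assms that by (simp add: convex_affine_manifold_def)
    then show ?thesis unfolding geod_def by (rule someI_ex)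
  qed
qed

lemma open_carrier_of: "topological_atlas M \<Longrightarrow> open (carrier_of M)"
  by (auto simp: carrier_of_def dest: topological_atlasD(1))

lemma geod_ends:
  assumes "convex_affine_manifold M" "x \<in> carrier_of M" "y \<in> carrier_of M"
  shows "geod M x y 0 = x" "geod M x y 1 = y"
  using convex_affine_manifoldD(3)[OF assms] by (auto simp: geodesic_from_to_def)

lemma geod_atlas_topological:
  assumes "convex_affine_manifold M"
  shows "topological_atlas (prod_atlas M (prod_atlas M (euclidean_atlas :: (real, real) affine_atlas)))"
  using convex_affine_manifoldD(1)[OF assms] topological_atlas_euclidean
  by (intro topological_atlas_prod)

lemma continuous_on_geod:
  assumes "convex_affine_manifold M"
  shows "continuous_on (carrier_of M \<times> carrier_of M \<times> {0..1}) (\<lambda>(x, y, s). geod M x y s)"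
proof (rule smooth_map_on_imp_continuous_on[OF _ geod_atlas_topological[OF assms]])
  show "smooth_map_on (prod_atlas M (prod_atlas M euclidean_atlas))
       (carrier_of M \<times> carrier_of M \<times> {0..1}) M (\<lambda>(x, y, s). geod M x y s)"
    using assms by (simp add: convex_affine_manifold_def)
qed (use convex_affine_manifoldD[OF assms] topological_atlasD in blast)

lemma geod_local_rep:
  assumes M: "convex_affine_manifold M" and "c \<in> M" "d \<in> M" "e \<in> M"
    and "x \<in> chart_dom c" "y \<in> chart_dom d" "s \<in> {0..1}" "geod M x y s \<in> chart_dom e"
  obtains W g where "open W" "(coord c x, coord d y, s) \<in> W" "smooth_on W g"
    "\<And>a b t. a \<in> chart_dom c \<Longrightarrow> b \<in> chart_dom d \<Longrightarrow> t \<in> {0..1} \<Longrightarrow> (coord c a, coord d b, t) \<in> W \<Longrightarrow>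
       geod M a b t \<in> chart_dom e \<and> coord e (geod M a b t) = g (coord c a, coord d b, t)"
proof -
  define R :: "(real, real) affine_chart" where
    "R = \<lparr>chart_dom = UNIV, coord = (\<lambda>x. x), christoffel = (\<lambda>_ _ _. 0)\<rparr>"
  define p where "p = prod_chart c (prod_chart d R)"
  have p: "p \<in> prod_atlas M (prod_atlas M euclidean_atlas)"
    using assms by (auto simp: p_def prod_atlas_def euclidean_atlas_def R_def)
  have dom: "chart_dom p = chart_dom c \<times> chart_dom d \<times> UNIV"
    and coord: "\<And>a b t. coord p (a, b, t) = (coord c a, coord d b, t)"
    by (simp_all add: p_def prod_chart_def R_def)
  have car: "chart_dom c \<subseteq> carrier_of M" "chart_dom d \<subseteq> carrier_of M"
    using assms by (auto simp: carrier_of_def)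
  have sm: "smooth_map_on (prod_atlas M (prod_atlas M euclidean_atlas))
       (carrier_of M \<times> carrier_of M \<times> {0..1}) M (\<lambda>(x, y, s::real). geod M x y s)"
    using M by (simp add: convex_affine_manifold_def)
  obtain W g where W: "open W" "coord p (x, y, s) \<in> W" "smooth_on W g" and
    rep: "\<And>a. a \<in> carrier_of M \<times> carrier_of M \<times> {0..1} \<Longrightarrow> a \<in> chart_dom p \<Longrightarrow> coord p a \<in> W \<Longrightarrow>
       (\<lambda>(x, y, s). geod M x y s) a \<in> chart_dom e \<and> coord e ((\<lambda>(x, y, s). geod M x y s) a) = g (coord p a)"
    by (rule smooth_map_on_local_rep[OF sm geod_atlas_topological[OF M] p assms(4), of "(x, y, s)"])
       (use assms car dom in auto)
  show ?thesis
  proof (rule that[OF W(1) _ W(3)])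
    show "(coord c x, coord d y, s) \<in> W" using W(2) by (simp add: coord)
    show "geod M a b t \<in> chart_dom e \<and> coord e (geod M a b t) = g (coord c a, coord d b, t)"
      if "a \<in> chart_dom c" "b \<in> chart_dom d" "t \<in> {0..1}" "(coord c a, coord d b, t) \<in> W" for a b t
      using rep[of "(a, b, t)"] that car by (auto simp: coord dom)
  qed
qed

section \<open>Initial velocities and first-order expansion of geodesics\<close>

lemma has_vector_derivative_third_variable:
  fixes g :: "'a::real_normed_vector \<times> 'b::real_normed_vector \<times> real \<Rightarrow> 'c::real_normed_vector"
  assumes "g differentiable (at (u, v, s))"
  shows "((\<lambda>t. g (u, v, t)) has_vector_derivative frechet_derivative g (at (u, v, s)) (0, 0, 1)) (at s within T)"
proof -
  let ?D = "frechet_derivative g (at (u, v, s))"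
  have g: "(g has_derivative ?D) (at (u, v, s))"
    using assms frechet_derivative_works by blast
  have "((\<lambda>t. (u, v, t)) has_derivative (\<lambda>h. (0, 0, h))) (at s within T)"
    by (intro derivative_intros)
  from has_derivative_compose[OF this g]
  have "((\<lambda>t. g (u, v, t)) has_derivative (\<lambda>h. ?D (0, 0, h))) (at s within T)" .
  moreover have "(\<lambda>h. ?D (0, 0, h)) = (\<lambda>h. h *\<^sub>R ?D (0, 0, 1))"
  proof
    show "?D (0, 0, h) = h *\<^sub>R ?D (0, 0, 1)" for h
      using linear_cmul[OF has_derivative_linear[OF g], of h "(0, 0, 1)"] by simp
  qed
  ultimately show ?thesis unfolding has_vector_derivative_def by argo
qed

text \<open>The geodesic to \<open>y\<close> starts at \<open>x\<close>, so near time 0 it can be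
  read in the chart \<open>c\<close>. Its initial velocity is then a partial derivative of one
  smooth map \<open>g\<close> of endpoints and time, and inherits continuity in both
  endpoints.\<close>

lemma exp_inv_local_rep:
  assumes M: "convex_affine_manifold M" and "c \<in> M" "d \<in> M" "x \<in> chart_dom c" "y \<in> chart_dom d"
  obtains W g where "open W" "(coord c x, coord d y, 0) \<in> W" "smooth_on W g"
    "\<And>a b t. a \<in> chart_dom c \<Longrightarrow> b \<in> chart_dom d \<Longrightarrow> t \<in> {0..1} \<Longrightarrow> (coord c a, coord d b, t) \<in> W \<Longrightarrow>
       geod M a b t \<in> chart_dom c \<and> coord c (geod M a b t) = g (coord c a, coord d b, t)"
    "\<And>a b. a \<in> chart_dom c \<Longrightarrow> b \<in> chart_dom d \<Longrightarrow> (coord c a, coord d b, 0) \<in> W \<Longrightarrow>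
       exp_inv M c a b = frechet_derivative g (at (coord c a, coord d b, 0)) (0, 0, 1)"
proof -
  have car: "x \<in> carrier_of M" "y \<in> carrier_of M"
    using assms by (auto simp: carrier_of_def)
  obtain W g where W: "open W" "(coord c x, coord d y, 0) \<in> W" "smooth_on W g" and
    rep: "\<And>a b t. a \<in> chart_dom c \<Longrightarrow> b \<in> chart_dom d \<Longrightarrow> t \<in> {0..1} \<Longrightarrow> (coord c a, coord d b, t) \<in> W \<Longrightarrow>
       geod M a b t \<in> chart_dom c \<and> coord c (geod M a b t) = g (coord c a, coord d b, t)"
    using geod_local_rep[OF M assms(2,3,2,4,5), of 0] geod_ends(1)[OF M car] assms(4) by auto
  show ?thesis
  proof (rule that[OF W rep])
    fix a b assume ab: "a \<in> chart_dom c" "b \<in> chart_dom d" "(coord c a, coord d b, 0) \<in> W"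
    let ?D = "frechet_derivative g (at (coord c a, coord d b, 0)) (0, 0, 1)"
    \<comment> \<open>\<open>W\<close> is open in the time variable too, so \<open>g\<close>
      represents the geodesic on a whole interval starting at 0, enough for the one-sided
      derivative.\<close>
    have "open ((\<lambda>t::real. (coord c a, coord d b, t)) -` W)"
      by (intro open_vimage W continuous_intros)
    then obtain r where r: "r > 0" "\<And>t. dist t 0 < r \<Longrightarrow> (coord c a, coord d b, t) \<in> W"
      using ab(3) unfolding open_dist by (metis vimageE vimageI2)
    have "((\<lambda>t. g (coord c a, coord d b, t)) has_vector_derivative ?D) (at 0 within {0..1})"
      by (rule has_vector_derivative_third_variable[OF smooth_on_differentiable[OF W(3) ab(3)]])
    then have "((\<lambda>t. coord c (geod M a b t)) has_vector_derivative ?D) (at 0 within {0..1})"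
      by (rule has_vector_derivative_transform_within[OF _ r(1)]) (use rep ab r(2) in auto)
    then show "exp_inv M c a b = ?D"
      unfolding exp_inv_def by (intro vector_derivative_within_closed_interval) auto
  qed
qed

text \<open>Supplies measurability and bounds on compact sets for the barycenter integral. The chart
  of the endpoint changes over the manifold, so continuity is checked near each \<open>y\<close>
  separately.\<close>

lemma continuous_on_exp_inv:
  assumes M: "convex_affine_manifold M" and c: "c \<in> M" "x \<in> chart_dom c"
  shows "continuous_on (carrier_of M) (exp_inv M c x)"
proof -
  have "continuous (at y) (exp_inv M c x)" if y: "y \<in> carrier_of M" for y
  proof -
    obtain d where d: "d \<in> M" "y \<in> chart_dom d" using y unfolding carrier_of_def by blast
    note dd = topological_atlasD[OF convex_affine_manifoldD(1)[OF M] d(1)]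
    obtain W g where W: "open W" "(coord c x, coord d y, 0::real) \<in> W" "smooth_on W g" and
      E: "\<And>b. b \<in> chart_dom d \<Longrightarrow> (coord c x, coord d b, 0) \<in> W \<Longrightarrow>
       exp_inv M c x b = frechet_derivative g (at (coord c x, coord d b, 0)) (0, 0, 1)"
      using exp_inv_local_rep[OF M c(1) d(1) c(2) d(2)] c by metis
    define N where "N = {b \<in> chart_dom d. coord d b \<in> (\<lambda>v. (coord c x, v, 0)) -` W}"
    have N: "open N" unfolding N_def
      by (intro open_coord_vimage[OF convex_affine_manifoldD(1)[OF M] d(1)] open_vimage W continuous_intros)
    have "y \<in> N" using d W by (simp add: N_def)
    have "continuous_on N (\<lambda>b. frechet_derivative g (at (coord c x, coord d b, 0)) (0, 0, 1))"
      by (rule continuous_on_compose2[OF smooth_on_continuous_on_derivative[OF W(3)]])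
         (auto simp: N_def intro!: continuous_intros intro: continuous_on_subset[OF dd(2)])
    then have "continuous_on N (exp_inv M c x)"
      by (rule continuous_on_eq) (simp add: N_def E)
    then show ?thesis using N \<open>y \<in> N\<close> continuous_on_eq_continuous_at by blast
  qed
  then show ?thesis by (simp add: continuous_at_imp_continuous_on)
qed

text \<open>The mean value inequality, applied to the geodesic minus its expected linear motion. The
  linear term uses the velocity at the fixed point \<open>x\<close> rather than at the start
  \<open>a\<close>, so that the contributions of successive steps of a walk near \<open>x\<close>
  can be added.\<close>

lemma geod_expansion_local:
  assumes M: "convex_affine_manifold M" and c: "c \<in> M" "x \<in> chart_dom c"
    and y: "y \<in> carrier_of M" and \<eta>: "\<eta> > 0"
  obtains N Q \<delta> where "open N" "x \<in> N" "open Q" "y \<in> Q" "Q \<subseteq> carrier_of M" "N \<subseteq> chart_dom c" "0 < \<delta>" "\<delta> \<le> 1"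
    "\<And>a b s. a \<in> N \<Longrightarrow> b \<in> Q \<Longrightarrow> 0 \<le> s \<Longrightarrow> s \<le> \<delta> \<Longrightarrow> geod M a b s \<in> chart_dom c \<and>
      norm (coord c (geod M a b s) - coord c a - s *\<^sub>R exp_inv M c x b) \<le> \<eta> * s"
proof -
  note top = convex_affine_manifoldD(1)[OF M]
  obtain d where d: "d \<in> M" "y \<in> chart_dom d" using y by (auto simp: carrier_of_def)
  obtain W g where W: "open W" "(coord c x, coord d y, 0::real) \<in> W" "smooth_on W g" and
    rep: "\<And>a b t. a \<in> chart_dom c \<Longrightarrow> b \<in> chart_dom d \<Longrightarrow> t \<in> {0..1} \<Longrightarrow> (coord c a, coord d b, t) \<in> W \<Longrightarrow>
       geod M a b t \<in> chart_dom c \<and> coord c (geod M a b t) = g (coord c a, coord d b, t)" and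
    E: "\<And>b. b \<in> chart_dom d \<Longrightarrow> (coord c x, coord d b, 0) \<in> W \<Longrightarrow>
       exp_inv M c x b = frechet_derivative g (at (coord c x, coord d b, 0)) (0, 0, 1)"
    using exp_inv_local_rep[OF M c(1) d(1) c(2) d(2)] c by metis
  define D where "D = (\<lambda>z. frechet_derivative g (at z) (0, 0, 1))"
  define z0 where "z0 = (coord c x, coord d y, 0::real)"
  \<comment> \<open>On \<open>W'\<close> the time derivative of \<open>g\<close> is within \<eta> /
    2 of its value at \<open>z0\<close>. One half of \<eta> pays for the motion along the geodesic,
    the other for replacing \<open>D z0\<close> by \<open>exp_inv M c x b\<close>.\<close>
  define W' where "W' = W \<inter> D -` ball (D z0) (\<eta> / 2)"
  have "open W'"
    unfolding W'_def D_def
    by (intro continuous_open_preimage smooth_on_continuous_on_derivative W open_ball)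
  moreover have "z0 \<in> W'" using W \<eta> by (simp add: W'_def z0_def)
  ultimately obtain A B C where ABC: "open A" "open B" "open C" "coord c x \<in> A" "coord d y \<in> B" "(0::real) \<in> C"
    "A \<times> B \<times> C \<subseteq> W'"
    unfolding z0_def by (smt (verit, best) Sigma_mono mem_Sigma_iff open_prod_elim order_refl order_trans)
  obtain r where r: "r > 0" "cball 0 r \<subseteq> C" using ABC open_contains_cball by blast
  define N where "N = {a \<in> chart_dom c. coord c a \<in> A}"
  define Q where "Q = {b \<in> chart_dom d. coord d b \<in> B}"
  define \<delta> where "\<delta> = min r 1"
  show ?thesis
  proof (rule that[of N Q \<delta>])
    show "open N" "open Q" unfolding N_def Q_def using open_coord_vimage[OF top] c d ABC by blast+
    show "x \<in> N" "y \<in> Q" using ABC c d by (auto simp: N_def Q_def)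
    show "Q \<subseteq> carrier_of M" using d by (auto simp: Q_def carrier_of_def)
    show "N \<subseteq> chart_dom c" by (auto simp: N_def)
    show "0 < \<delta>" "\<delta> \<le> 1" using r by (auto simp: \<delta>_def)
    fix a b s assume a: "a \<in> N" and b: "b \<in> Q" and s: "0 \<le> s" "s \<le> \<delta>"
    have ab: "a \<in> chart_dom c" "b \<in> chart_dom d" "a \<in> carrier_of M" "b \<in> carrier_of M"
      using a b c d by (auto simp: N_def Q_def carrier_of_def)
    have in_W': "(coord c a, coord d b, t) \<in> W'" "(coord c x, coord d b, t) \<in> W'" if "t \<in> {0..s}" for t
    proof -
      have "t \<in> C" using r(2) that s by (auto simp: \<delta>_def)
      then show "(coord c a, coord d b, t) \<in> W'" "(coord c x, coord d b, t) \<in> W'"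
        using a b ABC by (auto simp: N_def Q_def)
    qed
    have eq: "geod M a b t \<in> chart_dom c \<and> coord c (geod M a b t) = g (coord c a, coord d b, t)"
      if "t \<in> {0..s}" for t
      using rep[OF ab(1,2), of t] in_W'(1)[OF that] that s by (auto simp: W'_def \<delta>_def)
    have D_close: "norm (D z - D z0) \<le> \<eta> / 2" if "z \<in> W'" for z
      using that by (auto simp: W'_def dist_norm norm_minus_commute)
    let ?h = "\<lambda>t. g (coord c a, coord d b, t) - t *\<^sub>R D z0"
    have "norm (?h s - ?h 0) \<le> \<eta> / 2 * norm (s - 0)"
    proof (rule differentiable_bound[of "{0..s}" _ "\<lambda>t h. h *\<^sub>R (D (coord c a, coord d b, t) - D z0)"])
      fix t assume t: "t \<in> {0..s}"
      have "((\<lambda>t. g (coord c a, coord d b, t)) has_vector_derivative D (coord c a, coord d b, t)) (at t within {0..s})"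
        unfolding D_def
        by (rule has_vector_derivative_third_variable[OF smooth_on_differentiable[OF W(3)]])
           (use in_W'(1)[OF t] in \<open>simp add: W'_def\<close>)
      then have "(?h has_vector_derivative D (coord c a, coord d b, t) - D z0) (at t within {0..s})"
        by (auto intro!: derivative_eq_intros)
      then show "(?h has_derivative (\<lambda>h. h *\<^sub>R (D (coord c a, coord d b, t) - D z0))) (at t within {0..s})"
        by (simp add: has_vector_derivative_def)
      show "onorm (\<lambda>h. h *\<^sub>R (D (coord c a, coord d b, t) - D z0)) \<le> \<eta> / 2"
        using D_close[OF in_W'(1)[OF t]]
        by (simp add: onorm_scaleR_left onorm_id bounded_linear_ident)
    qed (use s in auto)
    then have 1: "norm (coord c (geod M a b s) - coord c a - s *\<^sub>R D z0) \<le> \<eta> / 2 * s"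
      using eq[of s] eq[of 0] s geod_ends(1)[OF M ab(3,4)] by (simp add: algebra_simps)
    have "norm (exp_inv M c x b - D z0) \<le> \<eta> / 2"
      using D_close[OF in_W'(2)[of 0]] E[OF ab(2)] in_W'(2)[of 0] s by (auto simp: D_def W'_def)
    then have 2: "norm (s *\<^sub>R (D z0 - exp_inv M c x b)) \<le> s * (\<eta> / 2)"
      using s by (simp add: norm_minus_commute mult_left_mono del: times_divide_eq_right)
    have "coord c (geod M a b s) - coord c a - s *\<^sub>R exp_inv M c x b =
        (coord c (geod M a b s) - coord c a - s *\<^sub>R D z0) + s *\<^sub>R (D z0 - exp_inv M c x b)"
      by (simp add: algebra_simps)
    also have "norm \<dots> \<le> \<eta> / 2 * s + s * (\<eta> / 2)"
      by (rule norm_triangle_mono[OF 1 2])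
    finally have "norm (coord c (geod M a b s) - coord c a - s *\<^sub>R exp_inv M c x b) \<le> \<eta> / 2 * s + s * (\<eta> / 2)" .
    then show "geod M a b s \<in> chart_dom c \<and>
        norm (coord c (geod M a b s) - coord c a - s *\<^sub>R exp_inv M c x b) \<le> \<eta> * s"
      using eq[of s] s by (simp add: algebra_simps)
  qed
qed

text \<open>Compactness enters through the target: finitely many of the sets \<open>Q y\<close>
  cover \<open>K\<close>, and neighbourhoods of \<open>x\<close> and times are intersected over this
  cover.\<close>

lemma geod_expansion:
  assumes M: "convex_affine_manifold M" and c: "c \<in> M" "x \<in> chart_dom c"
    and K: "compact K" "K \<subseteq> carrier_of M" and \<eta>: "\<eta> > 0"
  obtains N \<delta> where "open N" "x \<in> N" "N \<subseteq> chart_dom c" "0 < \<delta>"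
    "\<And>a b s. a \<in> N \<Longrightarrow> b \<in> K \<Longrightarrow> 0 \<le> s \<Longrightarrow> s \<le> \<delta> \<Longrightarrow> geod M a b s \<in> chart_dom c \<and>
      norm (coord c (geod M a b s) - coord c a - s *\<^sub>R exp_inv M c x b) \<le> \<eta> * s"
proof -
  define P where "P = (\<lambda>N Q \<delta>. open N \<and> x \<in> N \<and> open Q \<and> N \<subseteq> chart_dom c \<and> 0 < \<delta> \<and>
    (\<forall>a b s. a \<in> N \<longrightarrow> b \<in> Q \<longrightarrow> 0 \<le> s \<longrightarrow> s \<le> \<delta> \<longrightarrow> geod M a b s \<in> chart_dom c \<and>
      norm (coord c (geod M a b s) - coord c a - s *\<^sub>R exp_inv M c x b) \<le> \<eta> * s))"
  have "\<exists>N Q \<delta>. y \<in> Q \<and> P N Q \<delta>" if y: "y \<in> K" for y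
  proof (rule geod_expansion_local[OF M c subsetD[OF K(2) y] \<eta>])
    fix N Q \<delta>
    assume "open N" "x \<in> N" "open Q" "y \<in> Q" "N \<subseteq> chart_dom c" "0 < \<delta>"
      "\<And>a b s. a \<in> N \<Longrightarrow> b \<in> Q \<Longrightarrow> 0 \<le> s \<Longrightarrow> s \<le> \<delta> \<Longrightarrow> geod M a b s \<in> chart_dom c \<and>
        norm (coord c (geod M a b s) - coord c a - s *\<^sub>R exp_inv M c x b) \<le> \<eta> * s"
    then have "y \<in> Q \<and> P N Q \<delta>" by (simp add: P_def)
    then show ?thesis by blast
  qed
  then obtain N Q \<delta> where Q: "\<And>y. y \<in> K \<Longrightarrow> y \<in> Q y" and P: "\<And>y. y \<in> K \<Longrightarrow> P (N y) (Q y) (\<delta> y)"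
    by metis
  obtain F where F: "F \<subseteq> K" "finite F" "K \<subseteq> (\<Union>y\<in>F. Q y)"
    by (rule compactE_image[OF K(1), of K Q]) (use P Q in \<open>auto simp: P_def\<close>)
  \<comment> \<open>The entry 1, like \<open>chart_dom c\<close> in \<open>N'\<close>, takes care of
    an empty cover \<open>F\<close>.\<close>
  define \<delta>' where "\<delta>' = Min (insert 1 (\<delta> ` F))"
  define N' where "N' = chart_dom c \<inter> (\<Inter>y\<in>F. N y)"
  show ?thesis
  proof (rule that[of N' \<delta>'])
    have "open (\<Inter>y\<in>F. N y)"
      using F P by (intro open_INT) (auto simp: P_def subset_eq)
    then show "open N'" using topological_atlasD(1)[OF convex_affine_manifoldD(1)[OF M] c(1)]
      by (simp add: N'_def open_Int)
    show "x \<in> N'" using F P c by (auto simp: N'_def P_def subset_eq)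
    show "N' \<subseteq> chart_dom c" by (auto simp: N'_def)
    show "0 < \<delta>'" using F P by (auto simp: \<delta>'_def P_def subset_eq)
    fix a b s assume *: "a \<in> N'" "b \<in> K" "0 \<le> s" "s \<le> \<delta>'"
    obtain y where y: "y \<in> F" "b \<in> Q y" using F * by auto
    have "s \<le> \<delta> y" using *(4) y F by (simp add: \<delta>'_def)
    moreover have "a \<in> N y" using * y by (auto simp: N'_def)
    ultimately show "geod M a b s \<in> chart_dom c \<and>
      norm (coord c (geod M a b s) - coord c a - s *\<^sub>R exp_inv M c x b) \<le> \<eta> * s"
      using P[of y] y F * unfolding P_def by blast
  qed
qed

section \<open>Separating functions\<close>

lemma geodesic_on_restrict:
  assumes "geodesic_on A T \<gamma>" "\<gamma> ` T \<subseteq> U"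
  shows "geodesic_on (restrict_atlas U A) T \<gamma>"
  unfolding geodesic_on_def
proof (intro conjI ballI)
  show "continuous_on T \<gamma>" "\<gamma> ` T \<subseteq> carrier_of (restrict_atlas U A)"
    using assms by (auto simp: geodesic_on_def)
  fix c' assume "c' \<in> restrict_atlas U A"
  then obtain c where c: "c \<in> A" "c' = c\<lparr>chart_dom := chart_dom c \<inter> U\<rparr>"
    by (auto simp: restrict_atlas_def)
  obtain w where "\<forall>s\<in>T. \<gamma> s \<in> chart_dom c \<longrightarrow>
        ((\<lambda>t. coord c (\<gamma> t)) has_vector_derivative w s) (at s within T) \<and>
        (w has_vector_derivative - christoffel c (coord c (\<gamma> s)) (w s) (w s)) (at s within T)"
    using assms(1) c(1) unfolding geodesic_on_def by blast
  then show "\<exists>w. \<forall>s\<in>T. \<gamma> s \<in> chart_dom c' \<longrightarrow>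
        ((\<lambda>t. coord c' (\<gamma> t)) has_vector_derivative w s) (at s within T) \<and>
        (w has_vector_derivative - christoffel c' (coord c' (\<gamma> s)) (w s) (w s)) (at s within T)"
    using c(2) by auto
qed

lemma geodesic_on_prod:
  assumes "geodesic_on A T \<gamma>" "geodesic_on B T \<gamma>'"
  shows "geodesic_on (prod_atlas A B) T (\<lambda>s. (\<gamma> s, \<gamma>' s))"
  unfolding geodesic_on_def
proof (intro conjI ballI)
  show "continuous_on T (\<lambda>s. (\<gamma> s, \<gamma>' s))"
    using assms unfolding geodesic_on_def by (intro continuous_intros) auto
  show "(\<lambda>s. (\<gamma> s, \<gamma>' s)) ` T \<subseteq> carrier_of (prod_atlas A B)"
    using assms by (auto simp: geodesic_on_def)
  fix e assume "e \<in> prod_atlas A B"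
  then obtain c d where cd: "c \<in> A" "d \<in> B" "e = prod_chart c d"
    by (auto simp: prod_atlas_def)
  obtain w where w: "\<forall>s\<in>T. \<gamma> s \<in> chart_dom c \<longrightarrow>
        ((\<lambda>t. coord c (\<gamma> t)) has_vector_derivative w s) (at s within T) \<and>
        (w has_vector_derivative - christoffel c (coord c (\<gamma> s)) (w s) (w s)) (at s within T)"
    using assms(1) cd unfolding geodesic_on_def by blast
  obtain w' where w': "\<forall>s\<in>T. \<gamma>' s \<in> chart_dom d \<longrightarrow>
        ((\<lambda>t. coord d (\<gamma>' t)) has_vector_derivative w' s) (at s within T) \<and>
        (w' has_vector_derivative - christoffel d (coord d (\<gamma>' s)) (w' s) (w' s)) (at s within T)"
    using assms(2) cd unfolding geodesic_on_def by blast
  show "\<exists>w. \<forall>s\<in>T. (\<gamma> s, \<gamma>' s) \<in> chart_dom e \<longrightarrow>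
        ((\<lambda>t. coord e (\<gamma> t, \<gamma>' t)) has_vector_derivative w s) (at s within T) \<and>
        (w has_vector_derivative - christoffel e (coord e (\<gamma> s, \<gamma>' s)) (w s) (w s)) (at s within T)"
  proof (intro exI ballI impI conjI)
    fix s assume s: "s \<in> T" "(\<gamma> s, \<gamma>' s) \<in> chart_dom e"
    then have "\<gamma> s \<in> chart_dom c" "\<gamma>' s \<in> chart_dom d" by (auto simp: cd prod_chart_def)
    note d = w[rule_format, OF s(1) this(1)] w'[rule_format, OF s(1) this(2)]
    show "((\<lambda>t. coord e (\<gamma> t, \<gamma>' t)) has_vector_derivative (w s, w' s)) (at s within T)"
      using d by (auto simp: cd prod_chart_def intro: has_vector_derivative_Pair)
    show "((\<lambda>s. (w s, w' s)) has_vector_derivative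
        - christoffel e (coord e (\<gamma> s, \<gamma>' s)) (w s, w' s) (w s, w' s)) (at s within T)"
      using d by (auto simp: cd prod_chart_def intro: has_vector_derivative_Pair)
  qed
qed

lemma geod_in_convex_subset:
  assumes "convex_subset M U" "x \<in> U" "y \<in> U" "s \<in> {0..1}"
  shows "geod M x y s \<in> U"
  using assms unfolding convex_subset_def by blast

text \<open>Both geodesics end at \<open>y\<close>, where \<phi> vanishes, so convexity leaves only
  the initial term. Differentiated at time 0 this yields uniqueness; iterated along a walk it yields
  the contraction.\<close>

lemma separating_function_geod_le:
  assumes M: "convex_affine_manifold M" and U: "convex_subset M U"
    and \<phi>: "separating_function (restrict_atlas U M) \<phi>"
    and xy: "x \<in> U" "x' \<in> U" "y \<in> U" and s: "s \<in> {0..1}"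
  shows "\<phi> (geod M x y s, geod M x' y s) \<le> (1 - s) * \<phi> (x, x')"
proof -
  have car: "x \<in> carrier_of M" "x' \<in> carrier_of M" "y \<in> carrier_of M"
    using xy U by (auto simp: convex_subset_def)
  have "geodesic_on (restrict_atlas U M) {0..1} (geod M z y)" if "z \<in> U" for z
    using convex_affine_manifoldD(3)[OF M, of z y] that U car(3) xy(3)
    by (intro geodesic_on_restrict) (auto simp: geodesic_from_to_def convex_subset_def)
  then have "geodesic_on (prod_atlas (restrict_atlas U M) (restrict_atlas U M)) {0..1}
      (\<lambda>s. (geod M x y s, geod M x' y s))"
    using xy by (intro geodesic_on_prod)
  moreover have "\<And>T \<gamma>. is_interval T \<Longrightarrow> geodesic_on (prod_atlas (restrict_atlas U M) (restrict_atlas U M)) T \<gamma> \<Longrightarrow>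
      convex_on T (\<lambda>s. \<phi> (\<gamma> s))"
    using \<phi> by (simp add: separating_function_def convex_function_def)
  ultimately have "convex_on {0..1} (\<lambda>s. \<phi> (geod M x y s, geod M x' y s))"
    by (simp add: is_interval_cc)
  from convex_onD[OF this, of s 0 1]
  have "\<phi> (geod M x y s, geod M x' y s) \<le> (1 - s) * \<phi> (x, x') + s * \<phi> (y, y)"
    using s geod_ends[OF M] car by simp
  moreover have "\<phi> (y, y) = 0"
    using \<phi> xy car by (auto simp: separating_function_def)
  ultimately show ?thesis by simp
qed

lemma smooth_function_continuous_on:
  assumes "smooth_map_on A S (euclidean_atlas :: ('e::euclidean_space, 'e) affine_atlas) f" "topological_atlas A"
  shows "continuous_on S f"
proof (rule smooth_map_on_imp_continuous_on[OF assms])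
  fix d :: "('e, 'e) affine_chart" assume "d \<in> euclidean_atlas"
  then have d: "chart_dom d = UNIV" "coord d = (\<lambda>x. x)" by (auto simp: euclidean_atlas_def)
  then have "coord_inv d = (\<lambda>x. x)"
    by (auto simp: coord_inv_def fun_eq_iff inj_on_def intro!: inv_into_f_eq)
  then show "continuous_on (coord_image d) (coord_inv d) \<and> inj_on (coord d) (chart_dom d)"
    by (simp add: d continuous_on_id inj_on_def)
qed

text \<open>No triangle inequality is at hand for \<phi>, so the iterates of \<open>T\<close> are
  not shown to be Cauchy. Instead \<open>x\<close> minimises \<phi> (x, T x); the value at
  \<open>T x\<close> is at most \<open>q\<close> times the minimum, which forces the minimum to be
  0.\<close>

lemma contraction_fixpoint:
  fixes \<phi> :: "'a::t2_space \<times> 'a \<Rightarrow> real"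
  assumes C: "compact C" "C \<noteq> {}" and T: "continuous_on C T" "T ` C \<subseteq> C"
    and \<phi>: "continuous_on (C \<times> C) \<phi>"
    and sep: "\<And>x y. x \<in> C \<Longrightarrow> y \<in> C \<Longrightarrow> 0 \<le> \<phi> (x, y) \<and> (\<phi> (x, y) = 0 \<longleftrightarrow> x = y)"
    and q: "q < 1" "\<And>x y. x \<in> C \<Longrightarrow> y \<in> C \<Longrightarrow> \<phi> (T x, T y) \<le> q * \<phi> (x, y)"
  obtains x where "x \<in> C" "T x = x"
proof -
  have "continuous_on C (\<lambda>x. \<phi> (x, T x))"
    by (rule continuous_on_compose2[OF \<phi>]) (use T in \<open>auto intro!: continuous_intros\<close>)
  from continuous_attains_inf[OF C this]
  obtain x where x: "x \<in> C" "\<forall>y\<in>C. \<phi> (x, T x) \<le> \<phi> (y, T y)" by blast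
  have Tx: "T x \<in> C" using x T by auto
  have "\<phi> (x, T x) \<le> q * \<phi> (x, T x)"
    using bspec[OF x(2) Tx] q(2)[OF x(1) Tx] by linarith
  then have "(1 - q) * \<phi> (x, T x) \<le> 0" by (simp add: algebra_simps)
  then have "\<phi> (x, T x) = 0"
    using sep[OF x(1) Tx] q(1) by (simp add: mult_le_0_iff)
  then show ?thesis using that[of x] x sep[OF x(1) Tx] by auto
qed

text \<open>\<open>D\<close> is the derivative of \<phi> at \<open>(x, x')\<close> in charts. It is
  one linear map for all \<open>y\<close>, which is what allows the inequality to be integrated. For
  each \<open>y\<close> it is a limit of difference quotients that convexity bounds.\<close>

lemma separating_function_derivative_le:
  assumes M: "convex_affine_manifold M" and U: "open U" "convex_subset M U"
    and \<phi>: "separating_function (restrict_atlas U M) \<phi>"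
    and smooth: "smooth_map_on (prod_atlas (restrict_atlas U M) (restrict_atlas U M))
      (carrier_of (restrict_atlas U M) \<times> carrier_of (restrict_atlas U M))
      (euclidean_atlas :: (real, real) affine_atlas) \<phi>"
    and x: "x \<in> U" "x' \<in> U" and c: "c \<in> M" "c' \<in> M" "x \<in> chart_dom c" "x' \<in> chart_dom c'"
  obtains D where "bounded_linear D"
    "\<And>y. y \<in> U \<Longrightarrow> D (exp_inv M c x y, exp_inv M c' x' y) \<le> - \<phi> (x, x')"
proof -
  note top = convex_affine_manifoldD(1)[OF M]
  define N where "N = restrict_atlas U M"
  \<comment> \<open>Restricted charts keep their coordinates, so velocities computed in
    \<open>c\<close> and \<open>c'\<close> can be inserted into the derivative of \<phi>
    unchanged.\<close>
  define e where "e = c\<lparr>chart_dom := chart_dom c \<inter> U\<rparr>"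
  define e' where "e' = c'\<lparr>chart_dom := chart_dom c' \<inter> U\<rparr>"
  define R :: "(real, real) affine_chart" where
    "R = \<lparr>chart_dom = UNIV, coord = (\<lambda>x. x), christoffel = (\<lambda>_ _ _. 0)\<rparr>"
  have N: "topological_atlas (prod_atlas N N)"
    unfolding N_def by (intro topological_atlas_prod topological_atlas_restrict top U)
  have e: "prod_chart e e' \<in> prod_atlas N N" "R \<in> euclidean_atlas"
    using c by (auto simp: prod_atlas_def N_def restrict_atlas_def e_def e'_def euclidean_atlas_def R_def)
  have dom: "chart_dom (prod_chart e e') = (chart_dom c \<inter> U) \<times> (chart_dom c' \<inter> U)"
    and coord: "\<And>a b. coord (prod_chart e e') (a, b) = (coord c a, coord c' b)"
    by (auto simp: prod_chart_def e_def e'_def)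
  have carN: "carrier_of N = U" using U by (auto simp: N_def convex_subset_def)
  have sm: "smooth_map_on (prod_atlas N N) (U \<times> U) euclidean_atlas \<phi>"
    using smooth unfolding N_def[symmetric] carN .
  obtain W g where W: "open W" "coord (prod_chart e e') (x, x') \<in> W" "smooth_on W g" and
    rep0: "\<And>p. p \<in> U \<times> U \<Longrightarrow> p \<in> chart_dom (prod_chart e e') \<Longrightarrow> coord (prod_chart e e') p \<in> W \<Longrightarrow>
      \<phi> p \<in> chart_dom R \<and> coord R (\<phi> p) = g (coord (prod_chart e e') p)"
    by (rule smooth_map_on_local_rep[OF sm N e, of "(x, x')"]) (use x c in \<open>auto simp: dom R_def\<close>)
  have W2: "(coord c x, coord c' x') \<in> W" using W(2) by (simp add: coord)
  have rep: "\<phi> (a, b) = g (coord c a, coord c' b)"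
    if "a \<in> chart_dom c \<inter> U" "b \<in> chart_dom c' \<inter> U" "(coord c a, coord c' b) \<in> W" for a b
    using rep0[of "(a, b)"] that by (simp add: dom coord R_def)
  define D where "D = frechet_derivative g (at (coord c x, coord c' x'))"
  have D: "(g has_derivative D) (at (coord c x, coord c' x'))"
    using smooth_on_differentiable[OF W(3) W2] frechet_derivative_works unfolding D_def by blast
  show ?thesis
  proof (rule that)
    show "bounded_linear D" using D has_derivative_bounded_linear by blast
    fix y assume y: "y \<in> U"
    \<comment> \<open>\<open>exp_inv\<close> is a chosen \<open>vector_derivative\<close>; the
      geodesic equation shows that a derivative exists, with which the choice then agrees.\<close>
    have vel: "((\<lambda>s. coord d (geod M z y s)) has_vector_derivative exp_inv M d z y) (at 0 within {0..1})"
      and cont: "continuous_on {0..1} (geod M z y)" and start: "geod M z y 0 = z"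
      if "d \<in> M" "z \<in> chart_dom d" "z \<in> U" for d z
    proof -
      have geo: "geodesic_on M {0..1} (geod M z y)" and 0: "geod M z y 0 = z"
        using convex_affine_manifoldD(3)[OF M, of z y] U y that by (auto simp: geodesic_from_to_def convex_subset_def)
      from geo show "continuous_on {0..1} (geod M z y)" by (simp add: geodesic_on_def)
      show "geod M z y 0 = z" by (rule 0)
      from geo that(1) obtain w where
        "\<forall>s\<in>{0..1}. geod M z y s \<in> chart_dom d \<longrightarrow>
          ((\<lambda>t. coord d (geod M z y t)) has_vector_derivative w s) (at s within {0..1})"
        unfolding geodesic_on_def by blast
      then have w: "((\<lambda>t. coord d (geod M z y t)) has_vector_derivative w 0) (at 0 within {0..1})"
        using that 0 by auto
      then have "exp_inv M d z y = w 0"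
        unfolding exp_inv_def by (intro vector_derivative_within_closed_interval) auto
      then show "((\<lambda>s. coord d (geod M z y s)) has_vector_derivative exp_inv M d z y) (at 0 within {0..1})"
        using w by simp
    qed
    let ?v = "(exp_inv M c x y, exp_inv M c' x' y)"
    let ?\<gamma> = "\<lambda>s. (coord c (geod M x y s), coord c' (geod M x' y s))"
    let ?f = "\<lambda>s. \<phi> (geod M x y s, geod M x' y s)"
    have v: "(?\<gamma> has_vector_derivative ?v) (at 0 within {0..1})"
      by (intro has_vector_derivative_Pair vel c x)
    have st: "geod M x y 0 = x" "geod M x' y 0 = x'" using start c x by auto
    have "((\<lambda>s. g (?\<gamma> s)) has_vector_derivative D ?v) (at 0 within {0..1})"
      using vector_derivative_diff_chain_within[OF v] D has_derivative_at_withinI st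
      by (fastforce simp: comp_def)
    have g: "((\<lambda>s. (g (?\<gamma> s) - g (?\<gamma> 0)) / (s - 0)) \<longlongrightarrow> D ?v) (at 0 within {0..1})"
      using \<open>((\<lambda>s. g (?\<gamma> s)) has_vector_derivative D ?v) (at 0 within {0..1})\<close>
      by (simp add: has_field_derivative_iff flip: has_real_derivative_iff_has_vector_derivative)
    have lim: "(geod M z y \<longlongrightarrow> z) (at 0 within {0..1})" if "d \<in> M" "z \<in> chart_dom d" "z \<in> U" for d z
      using cont[OF that] start[OF that] unfolding continuous_on_def by force
    \<comment> \<open>For small times both geodesics lie in their charts with coordinates in
      \<open>W\<close>, where \<open>g\<close> represents \<phi>.\<close>
    have ev1: "\<forall>\<^sub>F s in at 0 within {0..1}. geod M x y s \<in> chart_dom c"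
      using topological_tendstoD[OF lim[OF c(1,3) x(1)]] topological_atlasD(1)[OF top] c by blast
    have ev2: "\<forall>\<^sub>F s in at 0 within {0..1}. geod M x' y s \<in> chart_dom c'"
      using topological_tendstoD[OF lim[OF c(2,4) x(2)]] topological_atlasD(1)[OF top] c by blast
    have "(?\<gamma> \<longlongrightarrow> ?\<gamma> 0) (at 0 within {0..1})"
      using has_vector_derivative_continuous[OF v] by (simp add: continuous_within)
    then have ev3: "\<forall>\<^sub>F s in at 0 within {0..1}. ?\<gamma> s \<in> W"
      using topological_tendstoD[OF _ W(1)] W2 st by auto
    \<comment> \<open>The filter omits 0, so the quotient below has a positive denominator.\<close>
    have in01: "\<forall>\<^sub>F s in at 0 within {0..1}. s \<in> {0<..1::real}"
      by (auto simp: eventually_at_filter)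
    have "\<forall>\<^sub>F s in at 0 within {0..1}. (g (?\<gamma> s) - g (?\<gamma> 0)) / (s - 0) \<le> - \<phi> (x, x')"
      using ev1 ev2 ev3 in01
    proof eventually_elim
      case (elim s)
      have U1: "geod M x y s \<in> U" "geod M x' y s \<in> U"
        using geod_in_convex_subset[OF U(2)] x y elim(4) by auto
      have "g (?\<gamma> s) = ?f s" using rep[of "geod M x y s" "geod M x' y s"] U1 elim by auto
      moreover have "g (?\<gamma> 0) = \<phi> (x, x')" using rep[of x x'] x c W2 st by auto
      moreover have "?f s \<le> (1 - s) * \<phi> (x, x')"
        using separating_function_geod_le[OF M U(2) \<phi> x y, of s] elim(4) by auto
      ultimately show ?case using elim(4) by (simp add: divide_simps algebra_simps)
    qed
    moreover have "at (0::real) within {0..1} \<noteq> bot"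
      by (simp add: trivial_limit_within islimpt_Icc)
    ultimately show "D ?v \<le> - \<phi> (x, x')"
      using tendsto_upperbound[OF g] by blast
  qed
qed

section \<open>Measures with compact support\<close>

text \<open>Second countability: each point outside the support lies in a basic open set with null
  trace, and there are only countably many of these.\<close>

lemma AE_measure_support:
  fixes \<mu> :: "'a::second_countable_topology measure"
  assumes "sets \<mu> = sets (restrict_space borel S)"
  shows "AE y in \<mu>. y \<in> measure_support \<mu>"
proof -
  obtain B :: "'a set set" where B: "countable B" "topological_basis B"
    using ex_countable_basis by blast
  have meas: "U \<inter> space \<mu> \<in> sets \<mu>" if "open U" for U
  proof -
    have "space \<mu> = S" using sets_eq_imp_space_eq[OF assms] by (simp add: space_restrict_space)
    then show ?thesis
      unfolding assms sets_restrict_space using that by (intro image_eqI[of _ _ U]) auto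
  qed
  define B0 where "B0 = {b \<in> B. emeasure \<mu> (b \<inter> space \<mu>) = 0}"
  have "AE y in \<mu>. y \<notin> b" if "b \<in> B0" for b
  proof (rule AE_I)
    show "b \<inter> space \<mu> \<in> sets \<mu>"
      using that meas topological_basis_open[OF B(2)] by (auto simp: B0_def)
    show "emeasure \<mu> (b \<inter> space \<mu>) = 0" using that by (simp add: B0_def)
  qed auto
  moreover have "countable B0" using B(1) by (simp add: B0_def)
  ultimately have "AE y in \<mu>. \<forall>b\<in>B0. y \<notin> b" by (simp add: AE_ball_countable)
  then show ?thesis
    using AE_space
  proof eventually_elim
    case (elim y)
    show ?case
    proof (rule ccontr)
      assume "y \<notin> measure_support \<mu>"
      then obtain U where U: "open U" "y \<in> U" "emeasure \<mu> (U \<inter> space \<mu>) = 0"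
        using elim(2) by (auto simp: measure_support_def)
      obtain b where b: "b \<in> B" "y \<in> b" "b \<subseteq> U"
        using topological_basisE[OF B(2) U(1,2)] by blast
      have "emeasure \<mu> (b \<inter> space \<mu>) \<le> emeasure \<mu> (U \<inter> space \<mu>)"
        using b meas[OF U(1)] by (intro emeasure_mono) auto
      then have "b \<in> B0" using b U by (simp add: B0_def)
      then show False using elim(1) b by blast
    qed
  qed
qed

text \<open>The cells are the patterns of membership in the first \<open>n\<close> basic open sets.
  A point of \<open>S\<close> shares its cell with its representative, so the representative enters
  each basic neighbourhood as soon as that neighbourhood has been enumerated; no metric is
  involved.\<close>

lemma finite_range_approximation:
  fixes S :: "'a::second_countable_topology set"
  assumes "S \<noteq> {}"
  obtains q :: "nat \<Rightarrow> 'a \<Rightarrow> 'a"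
  where "\<And>n. finite (range (q n))" "\<And>n y. q n y \<in> S" "\<And>n z. q n -` {z} \<in> sets borel"
    "\<And>y. y \<in> S \<Longrightarrow> (\<lambda>n. q n y) \<longlonglongrightarrow> y"
proof -
  obtain B :: "'a set set" where B: "countable B" "topological_basis B"
    using ex_countable_basis by blast
  have "B \<noteq> {}" using B(2) assms topological_basisE[OF B(2) open_UNIV] by blast
  define b where "b = from_nat_into B"
  have range_b: "range b = B" using B(1) \<open>B \<noteq> {}\<close> by (simp add: b_def range_from_nat_into)
  have open_b: "open (b i)" for i using range_b topological_basis_open[OF B(2)] by auto
  define P where "P = (\<lambda>n y. {i. i < n \<and> y \<in> b i})"
  \<comment> \<open>A pattern that no point of \<open>S\<close> realises is sent to an arbitrary
    point of \<open>S\<close>, so that \<open>q n\<close> is defined on the whole type with values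
    in \<open>S\<close>.\<close>
  define r where "r = (\<lambda>n Q. if \<exists>z\<in>S. P n z = Q then SOME z. z \<in> S \<and> P n z = Q else SOME z. z \<in> S)"
  define q where "q = (\<lambda>n y. r n (P n y))"
  have P_finite: "finite (range (P n))" for n
    by (rule finite_subset[of _ "Pow {..<n}"]) (auto simp: P_def)
  have r1: "r n Q \<in> S \<and> P n (r n Q) = Q" if "\<exists>z\<in>S. P n z = Q" for n Q
    using that someI_ex[of "\<lambda>z. z \<in> S \<and> P n z = Q"] by (auto simp: r_def)
  have r2: "r n Q \<in> S" for n Q
  proof (cases "\<exists>z\<in>S. P n z = Q")
    case False then show ?thesis using assms some_in_eq[of S] by (simp add: r_def)
  qed (use r1 in blast)
  have P_meas: "P n -` {Q} \<in> sets borel" for n Q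
  proof (cases "Q \<subseteq> {..<n}")
    case True
    have "P n -` {Q} = (\<Inter>i\<in>Q. b i) \<inter> (\<Inter>i\<in>{..<n} - Q. - b i)"
      using True by (auto simp: P_def)
    moreover have "finite Q" using True finite_subset by blast
    ultimately show ?thesis
      using open_b by (cases "Q = {}"; cases "{..<n} - Q = {}")
        (auto intro!: sets.Int sets.finite_INT borel_open borel_closed closed_Compl)
  next
    case False
    then have "P n -` {Q} = {}" by (auto simp: P_def)
    then show ?thesis by simp
  qed
  show ?thesis
  proof
    have "range (q n) = r n ` range (P n)" for n by (auto simp: q_def)
    then show "finite (range (q n))" for n using P_finite[of n] by simp
    show "q n y \<in> S" for n y using r2 by (simp add: q_def)
    show "q n -` {z} \<in> sets borel" for n z
    proof -
      have "q n -` {z} = (\<Union>Q\<in>range (P n) \<inter> {Q. r n Q = z}. P n -` {Q})"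
        by (auto simp: q_def)
      then show ?thesis using P_finite[of n] P_meas[of n] by (simp add: sets.finite_UN)
    qed
    show "(\<lambda>n. q n y) \<longlonglongrightarrow> y" if y: "y \<in> S" for y
    proof (rule topological_tendstoI)
      fix U assume U: "open U" "y \<in> U"
      obtain d where "d \<in> B" "y \<in> d" "d \<subseteq> U" using topological_basisE[OF B(2) U] by blast
      then obtain i where i: "y \<in> b i" "b i \<subseteq> U" using range_b by auto
      have *: "q n y \<in> U" if "i < n" for n
      proof -
        have "P n (q n y) = P n y" using r1[of n "P n y"] y by (auto simp: q_def)
        then have "q n y \<in> b i" using i(1) that by (auto simp: P_def)
        then show ?thesis using i(2) by blast
      qed
      show "\<forall>\<^sub>F n in sequentially. q n y \<in> U"
        by (rule eventually_mono[OF eventually_gt_at_top[of i] *])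
    qed
  qed
qed

lemma (in prob_space) expectation_finite_range:
  fixes f :: "'a \<Rightarrow> 'e::euclidean_space"
  assumes F: "finite F" "\<And>y. y \<in> space M \<Longrightarrow> q y \<in> F" and q: "\<And>z. z \<in> F \<Longrightarrow> q -` {z} \<inter> space M \<in> sets M"
  shows "expectation (\<lambda>y. f (q y)) = (\<Sum>z\<in>F. prob (q -` {z} \<inter> space M) *\<^sub>R f z)"
    and "(\<lambda>y. f (q y)) \<in> borel_measurable M"
proof -
  have eq: "f (q y) = (\<Sum>z\<in>F. indicator (q -` {z} \<inter> space M) y *\<^sub>R f z)" if "y \<in> space M" for y
  proof -
    have "(\<Sum>z\<in>F. indicator (q -` {z} \<inter> space M) y *\<^sub>R f z) = (\<Sum>z\<in>F. if z = q y then f z else 0)"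
      using that by (intro sum.cong) (auto simp: indicator_def)
    also have "\<dots> = f (q y)" using F that by (simp add: sum.delta')
    finally show ?thesis by simp
  qed
  have int: "integrable M (\<lambda>y. indicator (q -` {z} \<inter> space M) y *\<^sub>R f z)" if "z \<in> F" for z
    using q[OF that] by (intro integrable_scaleR_left integrable_real_indicator) (auto simp: emeasure_eq_measure)
  have "expectation (\<lambda>y. f (q y)) = expectation (\<lambda>y. \<Sum>z\<in>F. indicator (q -` {z} \<inter> space M) y *\<^sub>R f z)"
    by (rule Bochner_Integration.integral_cong) (auto simp: eq)
  also have "\<dots> = (\<Sum>z\<in>F. expectation (\<lambda>y. indicator (q -` {z} \<inter> space M) y *\<^sub>R f z))"
    by (rule Bochner_Integration.integral_sum) (rule int)
  also have "\<dots> = (\<Sum>z\<in>F. prob (q -` {z} \<inter> space M) *\<^sub>R f z)"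
    using q by (intro sum.cong) (auto simp: emeasure_eq_measure)
  finally show "expectation (\<lambda>y. f (q y)) = (\<Sum>z\<in>F. prob (q -` {z} \<inter> space M) *\<^sub>R f z)" .
  have "(\<lambda>y. \<Sum>z\<in>F. indicator (q -` {z} \<inter> space M) y *\<^sub>R f z) \<in> borel_measurable M"
    by (rule borel_measurable_sum) (rule borel_measurable_integrable[OF int])
  then show "(\<lambda>y. f (q y)) \<in> borel_measurable M"
    by (subst measurable_cong[OF eq])
qed

section \<open>Uniqueness\<close>

lemma exponential_barycenter_unique:
  fixes M :: "('a::{t2_space,second_countable_topology}, 'e::euclidean_space) affine_atlas"
  assumes "CSLCG M" and \<mu>: "prob_measure_on (carrier_of M) \<mu>" and S: "compact (measure_support \<mu>)"
    and x: "exponential_barycenter M \<mu> x" and x': "exponential_barycenter M \<mu> x'"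
  shows "x = x'"
proof -
  interpret prob_space \<mu> using \<mu> by (simp add: prob_measure_on_def)
  have M: "convex_affine_manifold M" using assms(1) by (simp add: CSLCG_def)
  have sets: "sets \<mu> = sets (restrict_space borel (carrier_of M))"
    using \<mu> by (simp add: prob_measure_on_def)
  have "space \<mu> = carrier_of M" using sets_eq_imp_space_eq[OF sets] by (simp add: space_restrict_space)
  then have "measure_support \<mu> \<subseteq> carrier_of M" by (auto simp: measure_support_def)
  moreover have car: "x \<in> carrier_of M" "x' \<in> carrier_of M"
    using x x' by (auto simp: exponential_barycenter_def)
  \<comment> \<open>Both candidates join the support in the compact set, so that one \<phi> compares
    them and covers almost every \<open>y\<close>.\<close>
  ultimately have K: "compact (insert x (insert x' (measure_support \<mu>)))"
      "insert x (insert x' (measure_support \<mu>)) \<subseteq> carrier_of M"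
    using S by auto
  then obtain U p where U: "open U" "insert x (insert x' (measure_support \<mu>)) \<subseteq> U" "convex_subset M U"
    and "p_convex_geometry p (restrict_atlas U M)"
    using assms(1) unfolding CSLCG_def by meson
  then obtain \<phi> where \<phi>: "separating_function (restrict_atlas U M) \<phi>"
    and smooth: "smooth_map_on (prod_atlas (restrict_atlas U M) (restrict_atlas U M))
      (carrier_of (restrict_atlas U M) \<times> carrier_of (restrict_atlas U M))
      (euclidean_atlas :: (real, real) affine_atlas) \<phi>"
    unfolding p_convex_geometry_def by blast
  obtain c c' where c: "c \<in> M" "c' \<in> M" "x \<in> chart_dom c" "x' \<in> chart_dom c'"
    using car by (auto simp: carrier_of_def)
  have xU: "x \<in> U" "x' \<in> U" using U by auto
  obtain D where D: "bounded_linear D"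
    and le: "\<And>y. y \<in> U \<Longrightarrow> D (exp_inv M c x y, exp_inv M c' x' y) \<le> - \<phi> (x, x')"
    by (rule separating_function_derivative_le[OF M U(1,3) \<phi> smooth xU c]) (rule that)
  \<comment> \<open>The two barycenter equations are separate integrals in possibly different
    charts; splitting \<open>D\<close> into its two components lets each be used on its own.\<close>
  have D1: "bounded_linear (\<lambda>u. D (u, 0))" and D2: "bounded_linear (\<lambda>v. D (0, v))"
    by (auto intro!: bounded_linear_compose[OF D] bounded_linear_intros)
  have split: "D (u, v) = D (u, 0) + D (0, v)" for u v
    using linear_add[OF bounded_linear.linear[OF D], of "(u, 0)" "(0, v)"] by simp
  have E: "integrable \<mu> (exp_inv M c x)" "(\<integral>y. exp_inv M c x y \<partial>\<mu>) = 0"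
    and E': "integrable \<mu> (exp_inv M c' x')" "(\<integral>y. exp_inv M c' x' y \<partial>\<mu>) = 0"
    using x x' c by (auto simp: exponential_barycenter_def)
  have int1: "integrable \<mu> (\<lambda>y. D (exp_inv M c x y, 0))" and int2: "integrable \<mu> (\<lambda>y. D (0, exp_inv M c' x' y))"
    using integrable_bounded_linear[OF D1 E(1)] integrable_bounded_linear[OF D2 E'(1)] by auto
  have int: "integrable \<mu> (\<lambda>y. D (exp_inv M c x y, exp_inv M c' x' y))"
    by (subst split) (intro Bochner_Integration.integrable_add int1 int2)
  have "(\<integral>y. D (exp_inv M c x y, exp_inv M c' x' y) \<partial>\<mu>)
      = (\<integral>y. D (exp_inv M c x y, 0) \<partial>\<mu>) + (\<integral>y. D (0, exp_inv M c' x' y) \<partial>\<mu>)"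
    by (subst split) (rule Bochner_Integration.integral_add[OF int1 int2])
  also have "\<dots> = 0"
    using integral_bounded_linear[OF D1 E(1)] integral_bounded_linear[OF D2 E'(1)] E(2) E'(2)
      linear_0[OF bounded_linear.linear[OF D]] by (simp flip: zero_prod_def)
  finally have "0 = (\<integral>y. D (exp_inv M c x y, exp_inv M c' x' y) \<partial>\<mu>)" by simp
  also have "\<dots> \<le> (\<integral>y. - \<phi> (x, x') \<partial>\<mu>)"
  proof (rule integral_mono_AE[OF int])
    show "AE y in \<mu>. D (exp_inv M c x y, exp_inv M c' x' y) \<le> - \<phi> (x, x')"
      using AE_measure_support[OF sets] by eventually_elim (use le U in auto)
  qed simp
  finally have "\<phi> (x, x') \<le> 0" by (simp add: prob_space)
  moreover have "0 \<le> \<phi> (x, x') \<and> (\<phi> (x, x') = 0 \<longleftrightarrow> x = x')"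
    using \<phi> xU car by (auto simp: separating_function_def)
  ultimately show ?thesis by linarith
qed

section \<open>Existence\<close>

text \<open>An entry \<open>(y, s)\<close> moves the current point the fraction \<open>s\<close> of
  the way to \<open>y\<close>. With times \<epsilon> times the weights of the atoms, the walk is to
  first order a step of size \<epsilon> along the averaged field, and to that order the sequence of
  the entries is immaterial.\<close>

definition geod_walk ::
    "('a::topological_space, 'e::euclidean_space) affine_atlas \<Rightarrow> ('a \<times> real) list \<Rightarrow> 'a \<Rightarrow> 'a" where
  "geod_walk M l x = fold (\<lambda>(y, s) z. geod M z y s) l x"

lemma geod_walk_simps [simp]:
  "geod_walk M [] x = x"
  "geod_walk M ((y, s) # l) x = geod_walk M l (geod M x y s)"
  by (simp_all add: geod_walk_def)

lemma geod_walk_in_convex_subset: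
  assumes "convex_subset M C" "x \<in> C" "set l \<subseteq> C \<times> {0..1}"
  shows "geod_walk M l x \<in> C"
  using assms(2,3)
proof (induction l arbitrary: x)
  case (Cons p l)
  then show ?case using geod_in_convex_subset[OF assms(1)] by (cases p) auto
qed simp

lemma continuous_on_geod_walk:
  assumes M: "convex_affine_manifold M" and C: "convex_subset M C" and "set l \<subseteq> C \<times> {0..1}"
  shows "continuous_on C (geod_walk M l)"
  using assms(3)
proof (induction l)
  case Nil
  have "geod_walk M [] = (\<lambda>x. x)" by (simp add: fun_eq_iff)
  then show ?case by (simp add: continuous_on_id)
next
  case (Cons p l)
  obtain y s where p: "p = (y, s)" by (cases p)
  have y: "y \<in> C" "s \<in> {0..1}" using Cons.prems by (auto simp: p)
  have "C \<subseteq> carrier_of M" using C by (simp add: convex_subset_def)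
  have "continuous_on C (\<lambda>x. (\<lambda>(x, y, s). geod M x y s) (x, y, s))"
    by (rule continuous_on_compose2[OF continuous_on_geod[OF M]])
       (use y \<open>C \<subseteq> carrier_of M\<close> in \<open>auto intro!: continuous_intros\<close>)
  then have "continuous_on C (\<lambda>x. geod M x y s)" by simp
  moreover have "(\<lambda>x. geod M x y s) ` C \<subseteq> C"
    using geod_in_convex_subset[OF C] y by auto
  moreover have "continuous_on C (geod_walk M l)" using Cons by simp
  ultimately have "continuous_on C (\<lambda>x. geod_walk M l (geod M x y s))"
    using continuous_on_compose2[of C "geod_walk M l" C "\<lambda>x. geod M x y s"] by simp
  moreover have "geod_walk M (p # l) = (\<lambda>x. geod_walk M l (geod M x y s))" by (simp add: p fun_eq_iff)
  ultimately show ?case by simp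
qed

text \<open>Each step contributes 1 - s \<le> exp (- s), and the product of these exponentials no
  longer sees how the total time is divided among the atoms.\<close>

lemma geod_walk_contraction:
  assumes M: "convex_affine_manifold M" and U: "convex_subset M U"
    and \<phi>: "separating_function (restrict_atlas U M) \<phi>"
    and xx': "x \<in> U" "x' \<in> U" and l: "set l \<subseteq> U \<times> {0..1}"
  shows "\<phi> (geod_walk M l x, geod_walk M l x') \<le> exp (- sum_list (map snd l)) * \<phi> (x, x')"
  using xx' l
proof (induction l arbitrary: x x')
  case (Cons p l)
  obtain y s where p: "p = (y, s)" by (cases p)
  have y: "y \<in> U" "s \<in> {0..1}" using Cons.prems by (auto simp: p)
  let ?S = "sum_list (map snd l)"
  have in_U: "geod M x y s \<in> U" "geod M x' y s \<in> U"
    using geod_in_convex_subset[OF U] Cons.prems y by auto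
  have "0 \<le> \<phi> (x, x')"
    using \<phi> Cons.prems U by (auto simp: separating_function_def convex_subset_def)
  have "1 - s \<le> exp (- s)" using exp_ge_add_one_self[of "- s"] by simp
  have "\<phi> (geod_walk M (p # l) x, geod_walk M (p # l) x')
      \<le> exp (- ?S) * \<phi> (geod M x y s, geod M x' y s)"
    using Cons.IH[OF in_U] Cons.prems by (simp add: p)
  also have "\<dots> \<le> exp (- ?S) * ((1 - s) * \<phi> (x, x'))"
    using separating_function_geod_le[OF M U \<phi> Cons.prems(1,2) y] by (intro mult_left_mono) auto
  also have "\<dots> \<le> exp (- ?S) * (exp (- s) * \<phi> (x, x'))"
    using \<open>1 - s \<le> exp (- s)\<close> \<open>0 \<le> \<phi> (x, x')\<close> by (intro mult_left_mono mult_right_mono) auto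
  also have "\<dots> = exp (- sum_list (map snd (p # l))) * \<phi> (x, x')"
    by (simp add: p flip: exp_add)
  finally show ?case .
qed simp

text \<open>\<open>step\<close> is available only near \<open>u\<close>, so the walk must stay in
  the ball until its last step. A step of time \<open>s\<close> moves the coordinates by at most
  \<open>(B + \<eta>) * s\<close>; \<open>small\<close> reserves this much for all the remaining
  time, and the induction hands the reserve on.\<close>

lemma geod_walk_expansion:
  assumes step: "\<And>a y s. a \<in> chart_dom c \<Longrightarrow> norm (coord c a - u) < r \<Longrightarrow> y \<in> K \<Longrightarrow> 0 \<le> s \<Longrightarrow> s \<le> \<delta> \<Longrightarrow>
      geod M a y s \<in> chart_dom c \<and> norm (coord c (geod M a y s) - coord c a - s *\<^sub>R E y) \<le> \<eta> * s"
    and E: "\<And>y. y \<in> K \<Longrightarrow> norm (E y) \<le> B" and \<eta>: "0 \<le> \<eta>"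
    and a: "a \<in> chart_dom c" and l: "set l \<subseteq> K \<times> {0..\<delta>}"
    and small: "norm (coord c a - u) + (B + \<eta>) * sum_list (map snd l) < r"
  shows "geod_walk M l a \<in> chart_dom c \<and>
    norm (coord c (geod_walk M l a) - coord c a - (\<Sum>(y, s)\<leftarrow>l. s *\<^sub>R E y)) \<le> \<eta> * sum_list (map snd l)"
  using a l small
proof (induction l arbitrary: a)
  case (Cons p l)
  obtain y s where p: "p = (y, s)" by (cases p)
  have y: "y \<in> K" "0 \<le> s" "s \<le> \<delta>" using Cons.prems by (auto simp: p)
  let ?S = "sum_list (map snd l)" and ?b = "geod M a y s"
  have "0 \<le> norm (E y)" by simp
  also have "\<dots> \<le> B" by (rule E[OF y(1)])
  finally have "0 \<le> B" .
  have S: "0 \<le> ?S" using Cons.prems(2) by (intro sum_list_nonneg) auto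
  have "0 \<le> (B + \<eta>) * (s + ?S)" using \<open>0 \<le> B\<close> \<eta> y S by simp
  then have "norm (coord c a - u) < r" using Cons.prems(3) by (simp add: p)
  note b = step[OF Cons.prems(1) this y]
  have "norm (coord c ?b - u) \<le> norm (coord c a - u) + (norm (coord c ?b - coord c a - s *\<^sub>R E y) + norm (s *\<^sub>R E y))"
    using norm_triangle_ineq[of "coord c a - u" "coord c ?b - coord c a"]
      norm_triangle_ineq[of "coord c ?b - coord c a - s *\<^sub>R E y" "s *\<^sub>R E y"] by simp
  moreover have "norm (s *\<^sub>R E y) \<le> s * B" using E[OF y(1)] y(2) by (simp add: mult_left_mono)
  ultimately have "norm (coord c ?b - u) \<le> norm (coord c a - u) + (B + \<eta>) * s"
    using b by (simp add: algebra_simps)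
  then have "norm (coord c ?b - u) + (B + \<eta>) * ?S < r"
    using Cons.prems(3) by (simp add: p algebra_simps)
  then have IH: "geod_walk M l ?b \<in> chart_dom c"
      "norm (coord c (geod_walk M l ?b) - coord c ?b - (\<Sum>(y, s)\<leftarrow>l. s *\<^sub>R E y)) \<le> \<eta> * ?S"
    using Cons.IH[of ?b] b Cons.prems(2) by auto
  have "coord c (geod_walk M (p # l) a) - coord c a - (\<Sum>(y, s)\<leftarrow>p # l. s *\<^sub>R E y) =
      (coord c (geod_walk M l ?b) - coord c ?b - (\<Sum>(y, s)\<leftarrow>l. s *\<^sub>R E y)) + (coord c ?b - coord c a - s *\<^sub>R E y)"
    by (simp add: p)
  also have "norm \<dots> \<le> \<eta> * ?S + \<eta> * s"
    by (rule norm_triangle_mono) (use IH b in auto)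
  finally show ?case using IH by (simp add: p algebra_simps)
qed simp

text \<open>If a point of the geodesic left the closure, continuity in the endpoints would make the
  same happen for nearby endpoints in \<open>V\<close>. The carrier need not be closed in the
  ambient type, hence the intersection.\<close>

lemma convex_subset_closure:
  fixes M :: "('a::{t2_space,second_countable_topology}, 'e::euclidean_space) affine_atlas"
  assumes M: "convex_affine_manifold M" and V: "convex_subset M V"
  shows "convex_subset M (carrier_of M \<inter> closure V)"
  unfolding convex_subset_def
proof (intro conjI ballI image_subsetI)
  fix x y and s :: real
  assume x: "x \<in> carrier_of M \<inter> closure V" and y: "y \<in> carrier_of M \<inter> closure V" and s: "s \<in> {0..1}"
  have "geodesic_on M {0..1} (geod M x y)"
    using convex_affine_manifoldD(3)[OF M, of x y] x y by (simp add: geodesic_from_to_def)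
  then have car: "geod M x y s \<in> carrier_of M" using s by (auto simp: geodesic_on_def)
  have "geod M x y s \<in> closure V"
  proof (rule ccontr)
    assume not: "geod M x y s \<notin> closure V"
    let ?f = "\<lambda>p. geod M (fst p) (snd p) s"
    let ?O = "(carrier_of M \<times> carrier_of M) \<inter> ?f -` (- closure V)"
    have "continuous_on (carrier_of M \<times> carrier_of M) (\<lambda>p. (\<lambda>(x, y, s). geod M x y s) (fst p, snd p, s))"
      by (rule continuous_on_compose2[OF continuous_on_geod[OF M]])
         (use s in \<open>auto intro!: continuous_intros\<close>)
    then have "open ?O"
      using open_carrier_of[OF convex_affine_manifoldD(1)[OF M]]
      by (intro continuous_open_preimage) (auto simp: open_Times)
    moreover have "(x, y) \<in> ?O" using x y not by simp
    ultimately obtain A B where AB: "open A" "open B" "(x, y) \<in> A \<times> B" "A \<times> B \<subseteq> ?O"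
      by (rule open_prod_elim)
    obtain a where a: "a \<in> A" "a \<in> V" using x AB closure_iff_nhds_not_empty[of x V] by blast
    obtain b where b: "b \<in> B" "b \<in> V" using y AB closure_iff_nhds_not_empty[of y V] by blast
    have "geod M a b s \<in> closure V"
      using geod_in_convex_subset[OF V a(2) b(2) s] closure_subset by blast
    then show False using AB(4) a b by auto
  qed
  then show "geod M x y s \<in> carrier_of M \<inter> closure V" using car by simp
qed auto

text \<open>\<open>CSLCG\<close> is used twice. A separating function for the neighbourhood
  \<open>V\<close> of \<open>K\<close> would say nothing on the boundary of \<open>V\<close>,
  whereas the fixed point needs compactness; so \<phi> is taken from a neighbourhood
  \<open>U\<close> of the compact closure \<open>C\<close> of \<open>V\<close> in
  \<open>M\<close>.\<close>

lemma compact_convex_with_separating_function: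
  fixes M :: "('a::{t2_space,second_countable_topology}, 'e::euclidean_space) affine_atlas"
  assumes "CSLCG M" "compact K" "K \<subseteq> carrier_of M"
  obtains C U \<phi> where "compact C" "K \<subseteq> C" "C \<subseteq> U" "convex_subset M C" "convex_subset M U"
    "separating_function (restrict_atlas U M) \<phi>" "continuous_on (C \<times> C) \<phi>"
proof -
  have M: "convex_affine_manifold M" using assms by (simp add: CSLCG_def)
  obtain V where V: "K \<subseteq> V" "convex_subset M V" "compact (carrier_of M \<inter> closure V)"
    using assms unfolding CSLCG_def by meson
  define C where "C = carrier_of M \<inter> closure V"
  have C: "compact C" "K \<subseteq> C" "convex_subset M C"
    using V assms(3) closure_subset[of V] convex_subset_closure[OF M V(2)] by (auto simp: C_def)
  obtain U p where U: "open U" "C \<subseteq> U" "convex_subset M U" and p: "p_convex_geometry p (restrict_atlas U M)"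
    using assms(1) C(1,3) unfolding CSLCG_def convex_subset_def by meson
  obtain \<phi> where \<phi>: "separating_function (restrict_atlas U M) \<phi>"
    and smooth: "smooth_map_on (prod_atlas (restrict_atlas U M) (restrict_atlas U M))
      (carrier_of (restrict_atlas U M) \<times> carrier_of (restrict_atlas U M))
      (euclidean_atlas :: (real, real) affine_atlas) \<phi>"
    using p unfolding p_convex_geometry_def by blast
  have "continuous_on (carrier_of (restrict_atlas U M) \<times> carrier_of (restrict_atlas U M)) \<phi>"
    using convex_affine_manifoldD(1)[OF M] U(1)
    by (intro smooth_function_continuous_on[OF smooth] topological_atlas_prod topological_atlas_restrict)
  moreover have "C \<times> C \<subseteq> carrier_of (restrict_atlas U M) \<times> carrier_of (restrict_atlas U M)"
    using U(2) C(3) by (auto simp: convex_subset_def)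
  ultimately have "continuous_on (C \<times> C) \<phi>" by (rule continuous_on_subset)
  then show ?thesis using that[of C U \<phi>] C U \<phi> by simp
qed

section \<open>Fixed points of walks and their limits\<close>

lemma geod_walk_fixpoint:
  assumes M: "convex_affine_manifold M" and C: "compact C" "C \<noteq> {}" "C \<subseteq> U" "convex_subset M C" "convex_subset M U"
    and \<phi>: "separating_function (restrict_atlas U M) \<phi>" "continuous_on (C \<times> C) \<phi>"
    and l: "set l \<subseteq> C \<times> {0..1}" "0 < sum_list (map snd l)"
  obtains x where "x \<in> C" "geod_walk M l x = x"
proof (rule contraction_fixpoint[OF C(1,2) continuous_on_geod_walk[OF M C(4) l(1)] _ \<phi>(2)])
  show "geod_walk M l ` C \<subseteq> C" using geod_walk_in_convex_subset[OF C(4) _ l(1)] by auto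
  show "exp (- sum_list (map snd l)) < 1" using l(2) by simp
  fix x y assume xy: "x \<in> C" "y \<in> C"
  have "x \<in> carrier_of (restrict_atlas U M)" "y \<in> carrier_of (restrict_atlas U M)"
    using xy C(3,4) by (auto simp: convex_subset_def)
  then show "0 \<le> \<phi> (x, y) \<and> (\<phi> (x, y) = 0 \<longleftrightarrow> x = y)"
    using \<phi>(1) unfolding separating_function_def by blast
  show "\<phi> (geod_walk M l x, geod_walk M l y) \<le> exp (- sum_list (map snd l)) * \<phi> (x, y)"
    by (rule geod_walk_contraction[OF M C(5) \<phi>(1)]) (use xy C(3) l(1) in auto)
qed (rule that)

text \<open>Rests on continuity of \<open>coord_inv\<close>, and turns a neighbourhood in the
  manifold into the coordinate distance by which \<open>geod_walk_expansion\<close> measures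
  nearness.\<close>

lemma chart_neighbourhood_ball:
  assumes "smooth_atlas A" "c \<in> A" "x \<in> chart_dom c" "open N" "x \<in> N"
  obtains r where "0 < r" "\<And>a. a \<in> chart_dom c \<Longrightarrow> norm (coord c a - coord c x) < r \<Longrightarrow> a \<in> N"
proof -
  have c: "open (coord_image c)" "continuous_on (coord_image c) (coord_inv c)"
    using assms(1,2) by (auto simp: smooth_atlas_def homeomorphism_def)
  note inv = coord_inv_coord[OF topological_atlasD(3)[OF smooth_atlas_imp_topological_atlas[OF assms(1)] assms(2)]]
  have "open (coord_image c \<inter> coord_inv c -` N)"
    by (rule continuous_open_preimage[OF c(2,1) assms(4)])
  moreover have "coord c x \<in> coord_image c \<inter> coord_inv c -` N"
    using assms(3,5) inv by (simp add: coord_image_def)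
  ultimately obtain r where r: "r > 0" "ball (coord c x) r \<subseteq> coord_image c \<inter> coord_inv c -` N"
    using open_contains_ball by blast
  show ?thesis
  proof (rule that[OF r(1)])
    fix a assume a: "a \<in> chart_dom c" "norm (coord c a - coord c x) < r"
    then have "coord c a \<in> coord_inv c -` N"
      using r(2) by (auto simp: dist_norm norm_minus_commute)
    then show "a \<in> N" using inv[OF a(1)] by simp
  qed
qed

text \<open>A limit of fixed points of ever shorter walks is critical: over a closed walk the displacements
  \<open>s *\<^sub>R exp_inv M c x y\<close> cancel up to an error of smaller order than the total time.\<close>

lemma limit_of_fixpoints_drift:
  fixes M :: "('a::{t2_space,second_countable_topology}, 'e::euclidean_space) affine_atlas"
  assumes M: "convex_affine_manifold M" and K: "compact K" "K \<subseteq> carrier_of M"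
    and l: "\<And>n. set (l n) \<subseteq> K \<times> {0..\<epsilon> n}" and total: "\<And>n. sum_list (map snd (l n)) = \<epsilon> n"
    and \<epsilon>: "\<epsilon> \<longlonglongrightarrow> 0" "\<And>n. 0 < \<epsilon> n"
    and fixp: "\<And>n. geod_walk M (l n) (z n) = z n" and lim: "z \<longlonglongrightarrow> x"
    and c: "c \<in> M" "x \<in> chart_dom c" and \<eta>: "0 < \<eta>"
  shows "\<forall>\<^sub>F n in sequentially. norm (\<Sum>(y, s)\<leftarrow>l n. s *\<^sub>R exp_inv M c x y) \<le> \<eta> * \<epsilon> n"
proof -
  let ?E = "exp_inv M c x"
  note top = convex_affine_manifoldD(1)[OF M]
  have sm: "smooth_atlas M" using M by (simp add: convex_affine_manifold_def affine_manifold_def)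
  have "compact (?E ` K)"
    using continuous_on_subset[OF continuous_on_exp_inv[OF M c] K(2)] K(1) by (rule compact_continuous_image)
  then obtain B where B: "\<And>y. y \<in> K \<Longrightarrow> norm (?E y) \<le> B"
    using compact_imp_bounded[THEN bounded_iff[THEN iffD1]] by force
  show ?thesis
  proof (rule geod_expansion[OF M c K \<eta>])
    fix N \<delta> assume N: "open N" "x \<in> N" "0 < (\<delta>::real)"
      and expansion: "\<And>a b s. a \<in> N \<Longrightarrow> b \<in> K \<Longrightarrow> 0 \<le> s \<Longrightarrow> s \<le> \<delta> \<Longrightarrow> geod M a b s \<in> chart_dom c \<and>
        norm (coord c (geod M a b s) - coord c a - s *\<^sub>R ?E b) \<le> \<eta> * s"
    obtain r where r: "0 < r" and rN: "\<And>a. a \<in> chart_dom c \<Longrightarrow> norm (coord c a - coord c x) < r \<Longrightarrow> a \<in> N"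
      by (rule chart_neighbourhood_ball[OF sm c N(1,2)]) (rule that)
    have dom: "\<forall>\<^sub>F n in sequentially. z n \<in> chart_dom c"
      by (rule topological_tendstoD[OF lim topological_atlasD(1)[OF top c(1)] c(2)])
    have "isCont (coord c) x"
      using topological_atlasD(1,2)[OF top c(1)] c(2) continuous_on_eq_continuous_at by metis
    then have "(\<lambda>n. coord c (z n)) \<longlonglongrightarrow> coord c x" by (rule isCont_tendsto_compose[OF _ lim])
    \<comment> \<open>Since \<epsilon> n is the total time of the walk, this is the quantity that
      \<open>geod_walk_expansion\<close> requires to be less than \<open>r\<close>.\<close>
    then have "(\<lambda>n. norm (coord c (z n) - coord c x) + (B + \<eta>) * \<epsilon> n) \<longlonglongrightarrow> norm (coord c x - coord c x) + (B + \<eta>) * 0"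
      by (intro tendsto_intros \<epsilon>)
    then have small: "\<forall>\<^sub>F n in sequentially. norm (coord c (z n) - coord c x) + (B + \<eta>) * \<epsilon> n < r"
      by (rule order_tendstoD) (use r in simp)
    have "\<forall>\<^sub>F n in sequentially. \<epsilon> n < \<delta>" using \<epsilon>(1) N(3) by (rule order_tendstoD)
    with dom small show ?thesis
    proof eventually_elim
      case (elim n)
      have "set (l n) \<subseteq> K \<times> {0..\<delta>}" using l[of n] elim(3) by fastforce
      note walk = geod_walk_expansion[where c = c and M = M and u = "coord c x" and r = r and K = K and \<delta> = \<delta>
          and E = ?E and \<eta> = \<eta> and B = B and a = "z n" and l = "l n",
          OF expansion[OF rN] B less_imp_le[OF \<eta>] elim(1) this]
      have "norm (coord c (geod_walk M (l n) (z n)) - coord c (z n) - (\<Sum>(y, s)\<leftarrow>l n. s *\<^sub>R ?E y)) \<le> \<eta> * \<epsilon> n"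
        using walk elim(2) by (simp add: total)
      then show ?case by (simp add: fixp)
    qed
  qed
qed

lemma exponential_barycenter_exists:
  fixes M :: "('a::{t2_space,second_countable_topology}, 'e::euclidean_space) affine_atlas"
  assumes "CSLCG M" and \<mu>: "prob_measure_on (carrier_of M) \<mu>" and S: "compact (measure_support \<mu>)"
  shows "\<exists>x. exponential_barycenter M \<mu> x"
proof -
  interpret prob_space \<mu> using \<mu> by (simp add: prob_measure_on_def)
  define S where "S = measure_support \<mu>"
  have M: "convex_affine_manifold M" using assms(1) by (simp add: CSLCG_def)
  have sets: "sets \<mu> = sets (restrict_space borel (carrier_of M))"
    using \<mu> by (simp add: prob_measure_on_def)
  have space: "space \<mu> = carrier_of M" using sets_eq_imp_space_eq[OF sets] by (simp add: space_restrict_space)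
  have Ssub: "S \<subseteq> carrier_of M" by (auto simp: space[symmetric] S_def measure_support_def)
  have "compact S" using assms(3) by (simp add: S_def)
  have AE_S: "AE y in \<mu>. y \<in> S" unfolding S_def by (rule AE_measure_support[OF sets])
  have "S \<noteq> {}"
  proof
    assume "S = {}"
    then show False using AE_S by (simp add: AE_False)
  qed
  obtain q :: "nat \<Rightarrow> 'a \<Rightarrow> 'a" where
    q: "\<And>n. finite (range (q n))" "\<And>n y. q n y \<in> S" "\<And>n z. q n -` {z} \<in> sets borel"
      "\<And>y. y \<in> S \<Longrightarrow> (\<lambda>n. q n y) \<longlonglongrightarrow> y"
    by (rule finite_range_approximation[OF \<open>S \<noteq> {}\<close>]) (rule that)
  have q_meas: "q n -` {z} \<inter> space \<mu> \<in> sets \<mu>" for n z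
    unfolding sets sets_restrict_space space using q(3)[of n z] by (intro image_eqI[of _ _ "q n -` {z}"]) auto
  define w where "w = (\<lambda>n z. prob (q n -` {z} \<inter> space \<mu>))"
  \<comment> \<open>Stated for every \<open>f\<close>, as is \<open>l_sum\<close> below: the
    constant 1 gives the total weight, \<open>exp_inv M c x\<close> the discretised barycenter
    integral.\<close>
  have discrete: "expectation (\<lambda>y. f (q n y)) = (\<Sum>z\<in>range (q n). w n z *\<^sub>R f z)"
    and discrete_meas: "(\<lambda>y. f (q n y)) \<in> borel_measurable \<mu>" for n and f :: "'a \<Rightarrow> 'v::euclidean_space"
    unfolding w_def using expectation_finite_range[of "range (q n)" "q n" f] q(1) q_meas by auto
  have w_sum: "(\<Sum>z\<in>range (q n). w n z) = 1" for n
    using discrete[of "\<lambda>_. 1::real" n] by (simp add: prob_space)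
  \<comment> \<open>Any null sequence in (0, 1] would do; the bound 1 keeps every step inside the
    time interval of a geodesic.\<close>
  define \<epsilon> where "\<epsilon> = (\<lambda>n. 1 / real (Suc n))"
  have \<epsilon>: "\<epsilon> \<longlonglongrightarrow> 0" "\<And>n. 0 < \<epsilon> n" "\<And>n. \<epsilon> n \<le> 1"
    using LIMSEQ_inverse_real_of_nat by (auto simp: \<epsilon>_def inverse_eq_divide)
  \<comment> \<open>Distinctness makes sums over the list equal to sums over the range, so that each
    atom is visited once.\<close>
  have "\<exists>zs. set zs = range (q n) \<and> distinct zs" for n
    by (rule finite_distinct_list[OF q(1)])
  then obtain zs where zs: "\<And>n. set (zs n) = range (q n)" "\<And>n. distinct (zs n)" by metis
  define l where "l = (\<lambda>n. map (\<lambda>z. (z, \<epsilon> n * w n z)) (zs n))"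
  have l_sum: "(\<Sum>(y, s)\<leftarrow>l n. s *\<^sub>R f y) = \<epsilon> n *\<^sub>R (\<Sum>z\<in>range (q n). w n z *\<^sub>R f z)"
    for n and f :: "'a \<Rightarrow> 'v::real_vector"
    by (simp add: l_def comp_def sum_list_distinct_conv_sum_set zs scaleR_sum_right)
  have total: "sum_list (map snd (l n)) = \<epsilon> n" for n
    using l_sum[of "\<lambda>_. 1::real" n] w_sum[of n] by (simp add: l_def comp_def)
  have w01: "0 \<le> w n z" "w n z \<le> 1" for n z by (auto simp: w_def)
  have l_set: "set (l n) \<subseteq> S \<times> {0..\<epsilon> n}" for n
    using zs(1)[of n] q(2) w01 \<epsilon>(2)[of n] by (auto simp: l_def mult_left_le)
  obtain C U \<phi> where C: "compact C" "S \<subseteq> C" "C \<subseteq> U" "convex_subset M C" "convex_subset M U"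
    and \<phi>: "separating_function (restrict_atlas U M) \<phi>" "continuous_on (C \<times> C) \<phi>"
    by (rule compact_convex_with_separating_function[OF assms(1) \<open>compact S\<close> Ssub]) (rule that)
  have "C \<noteq> {}" using \<open>S \<noteq> {}\<close> C(2) by auto
  have "\<exists>x. x \<in> C \<and> geod_walk M (l n) x = x" for n
  proof -
    have "set (l n) \<subseteq> C \<times> {0..1}" using l_set[of n] C(2) \<epsilon>(3)[of n] by fastforce
    from geod_walk_fixpoint[OF M C(1) \<open>C \<noteq> {}\<close> C(3-5) \<phi> this]
    show ?thesis using total[of n] \<epsilon>(2)[of n] by auto
  qed
  then obtain z where z: "\<And>n. z n \<in> C" "\<And>n. geod_walk M (l n) (z n) = z n" by metis
  \<comment> \<open>Convergence holds along \<sigma> only, so the drift estimate is applied below to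
    the subsequence of walks.\<close>
  obtain x \<sigma> where x: "x \<in> C" "strict_mono \<sigma>" "(z \<circ> \<sigma>) \<longlonglongrightarrow> x"
    using seq_compactE[OF compact_imp_seq_compact[OF C(1)], of z] z(1) by auto
  have "exponential_barycenter M \<mu> x"
    unfolding exponential_barycenter_def
  proof (intro conjI ballI impI)
    show "x \<in> carrier_of M" using x(1) C(4) by (auto simp: convex_subset_def)
    fix c assume c: "c \<in> M" "x \<in> chart_dom c"
    let ?E = "exp_inv M c x"
    note cont = continuous_on_exp_inv[OF M c]
    have "compact (?E ` S)"
      using continuous_on_subset[OF cont Ssub] \<open>compact S\<close> by (rule compact_continuous_image)
    then obtain B where B: "\<And>y. y \<in> S \<Longrightarrow> norm (?E y) \<le> B"
      using compact_imp_bounded[THEN bounded_iff[THEN iffD1]] by force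
    have "?E \<in> borel_measurable (restrict_space borel (carrier_of M))"
      by (rule borel_measurable_continuous_on_restrict[OF cont])
    then have E_meas: "?E \<in> borel_measurable \<mu>"
      using measurable_cong_sets[OF sets refl] by blast
    have AE_B: "AE y in \<mu>. norm (?E y) \<le> B" using AE_S by eventually_elim (rule B)
    show "integrable \<mu> ?E" by (rule integrable_const_bound[OF AE_B E_meas])
    have lim: "(\<lambda>n. expectation (\<lambda>y. ?E (q n y))) \<longlonglongrightarrow> expectation ?E"
    proof (rule integral_dominated_convergence)
      show "integrable \<mu> (\<lambda>_. B)" by simp
      show "AE y in \<mu>. (\<lambda>n. ?E (q n y)) \<longlonglongrightarrow> ?E y"
        using AE_S
      proof eventually_elim
        case (elim y)
        show ?case
          by (rule continuous_on_tendsto_compose[OF cont q(4)[OF elim]])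
             (use elim Ssub q(2) in \<open>auto simp: subset_eq intro!: always_eventually\<close>)
      qed
    qed (use E_meas discrete_meas B q(2) in auto)
    have small: "norm (expectation ?E) \<le> \<eta>" if \<eta>: "0 < \<eta>" for \<eta>
    proof (rule tendsto_upperbound)
      show "(\<lambda>n. norm (expectation (\<lambda>y. ?E (q (\<sigma> n) y)))) \<longlonglongrightarrow> norm (expectation ?E)"
        using LIMSEQ_subseq_LIMSEQ[OF lim x(2)] by (intro tendsto_norm) (simp add: comp_def)
      have "(\<lambda>n. \<epsilon> (\<sigma> n)) \<longlonglongrightarrow> 0"
        using LIMSEQ_subseq_LIMSEQ[OF \<epsilon>(1) x(2)] by (simp add: comp_def)
      moreover have "(\<lambda>n. z (\<sigma> n)) \<longlonglongrightarrow> x" using x(3) by (simp add: comp_def)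
      ultimately have "\<forall>\<^sub>F n in sequentially. norm (\<Sum>(y, s)\<leftarrow>l (\<sigma> n). s *\<^sub>R ?E y) \<le> \<eta> * \<epsilon> (\<sigma> n)"
        using limit_of_fixpoints_drift[OF M \<open>compact S\<close> Ssub, of "\<lambda>n. l (\<sigma> n)" "\<lambda>n. \<epsilon> (\<sigma> n)" "\<lambda>n. z (\<sigma> n)" x c \<eta>]
          l_set total \<epsilon>(2) z(2) c \<eta> by simp
      then show "\<forall>\<^sub>F n in sequentially. norm (expectation (\<lambda>y. ?E (q (\<sigma> n) y))) \<le> \<eta>"
      proof eventually_elim
        case (elim n)
        \<comment> \<open>The sum in the drift estimate is \<epsilon> times the discretised
          integral; cancelling \<epsilon> leaves the arbitrary \<eta>.\<close>
        then have "\<epsilon> (\<sigma> n) * norm (expectation (\<lambda>y. ?E (q (\<sigma> n) y))) \<le> \<epsilon> (\<sigma> n) * \<eta>"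
          using \<epsilon>(2)[of "\<sigma> n"] by (simp add: l_sum discrete mult.commute)
        then show ?case using \<epsilon>(2)[of "\<sigma> n"] by simp
      qed
    qed simp
    have "norm (expectation ?E) \<le> 0" by (rule field_le_epsilon) (use small in simp)
    then show "expectation ?E = 0" by simp
  qed
  then show ?thesis by blast
qed

theorem proposition2p4:
  fixes M :: "('a::{t2_space,second_countable_topology}, 'e::euclidean_space) affine_atlas"
    and \<mu> :: "'a measure"
  assumes "CSLCG M"
    and "prob_measure_on (carrier_of M) \<mu>"
    and "compact (measure_support \<mu>)"
  shows "\<exists>!x. exponential_barycenter M \<mu> x"
  using exponential_barycenter_exists[OF assms] exponential_barycenter_unique[OF assms] by (rule ex_ex1I)

end
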